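(* Let $N$ be a Riemannian manifold that has $\mathrm{Ric}_k|_p\leq 0$ at a point $p\in N$ for some $k\in\{1,\dots,\dim N-1\}$. Suppose $f:N\to M$ is an isometric immersion into a Riemannian manifold $M$ such that $$\sum_{i=1}^k\mathrm{sec}_M(f_*(u),f_*(e_i))>0$$ for all orthonormal vectors $u,e_1,\dots,e_k\in T_pN$. Then $$\dim N\leq\left\lfloor\frac{\dim M+k}{2}\right\rfloor.$$
   Context: $\mathrm{sec}_M(x,y)$ (resp. $\mathrm{sec}_N(x,y)$) denotes the sectional curvature in $M$ (resp. in $N$) of the plane spanned by $x,y$. The condition "$N$ has $\mathrm{Ric}_k|_p\leq 0$" means that $\sum_{i=1}^k\mathrm{sec}_N(u,e_i)\leq 0$ for all orthonormal vectors $u,e_1,\dots,e_k\in T_pN$. $f_*$ denotes the differential of $f$ at $p$. *)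

theory Defs
  imports "HOL-Analysis.Analysis"
begin

subsection \<open>Smooth functions on open subsets of Euclidean spaces\<close>

primrec Ck_on :: "nat \<Rightarrow> 'a::euclidean_space set \<Rightarrow> ('a \<Rightarrow> 'b::real_normed_vector) \<Rightarrow> bool" where
  "Ck_on 0 S f \<longleftrightarrow> continuous_on S f"
| "Ck_on (Suc k) S f \<longleftrightarrow> (\<forall>x\<in>S. f differentiable (at x)) \<and>
     (\<forall>v. Ck_on k S (\<lambda>x. frechet_derivative f (at x) v))"

definition smooth_on :: "'a::euclidean_space set \<Rightarrow> ('a \<Rightarrow> 'b::real_normed_vector) \<Rightarrow> bool" where
  "smooth_on S f \<longleftrightarrow> (\<forall>k. Ck_on k S f)"


subsection \<open>Smooth manifolds\<close>

text \<open>A chart is a pair of its domain and its coordinate map; only the values of the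
  coordinate map on the domain matter. An n-dimensional manifold is modelled on a Euclidean
  space \<open>'a\<close> with \<open>DIM('a) = n\<close>. A tangent vector at a point is represented by the family of its
  coordinate vectors in all charts of the atlas around the point, related by the derivatives of
  the coordinate changes (and zero at all other charts).\<close>

type_synonym ('p, 'a) chart = "'p set \<times> ('p \<Rightarrow> 'a)"
type_synonym ('p, 'a) tangent_vector = "('p, 'a) chart \<Rightarrow> 'a"

record ('p, 'a) riemannian =
  top_of :: "'p topology"
  atlas :: "('p, 'a) chart set"
  metric :: "'p \<Rightarrow> ('p, 'a) tangent_vector \<Rightarrow> ('p, 'a) tangent_vector \<Rightarrow> real"

definition chart_inv :: "('p, 'a) chart \<Rightarrow> 'a \<Rightarrow> 'p" where
  "chart_inv c = inv_into (fst c) (snd c)"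

definition smooth_manifold :: "'p topology \<Rightarrow> ('p, 'a::euclidean_space) chart set \<Rightarrow> bool" where
  "smooth_manifold T A \<longleftrightarrow>
     Hausdorff_space T \<and> second_countable T \<and> (\<Union>c\<in>A. fst c) = topspace T \<and>
     (\<forall>c\<in>A. openin T (fst c) \<and> open (snd c ` fst c) \<and>
        homeomorphic_map (subtopology T (fst c)) (top_of_set (snd c ` fst c)) (snd c)) \<and>
     (\<forall>c\<in>A. \<forall>d\<in>A. smooth_on (snd c ` (fst c \<inter> fst d)) (snd d \<circ> chart_inv c))"

definition charts_at :: "('p, 'a) riemannian \<Rightarrow> 'p \<Rightarrow> ('p, 'a) chart set" where
  "charts_at N p = {c \<in> atlas N. p \<in> fst c}"

definition coord_change :: "('p, 'a::euclidean_space) chart \<Rightarrow> ('p, 'a) chart \<Rightarrow> 'p \<Rightarrow> 'a \<Rightarrow> 'a" where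
  "coord_change c d p = frechet_derivative (snd d \<circ> chart_inv c) (at (snd c p))"

definition tangent_space ::
    "('p, 'a::euclidean_space) riemannian \<Rightarrow> 'p \<Rightarrow> ('p, 'a) tangent_vector set" where
  "tangent_space N p =
     {v. (\<forall>c\<in>charts_at N p. \<forall>d\<in>charts_at N p. v d = coord_change c d p (v c)) \<and>
         (\<forall>c. c \<notin> charts_at N p \<longrightarrow> v c = 0)}"

text \<open>The tangent vector at \<open>p\<close> whose coordinate vector in the chart \<open>c\<close> is \<open>u\<close>.\<close>

definition coord_vector ::
    "('p, 'a::euclidean_space) riemannian \<Rightarrow> 'p \<Rightarrow> ('p, 'a) chart \<Rightarrow> 'a \<Rightarrow> ('p, 'a) tangent_vector" where
  "coord_vector N p c u = (\<lambda>d. if d \<in> charts_at N p then coord_change c d p u else 0)"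

definition chart_at :: "('p, 'a) riemannian \<Rightarrow> 'p \<Rightarrow> ('p, 'a) chart" where
  "chart_at N p = (SOME c. c \<in> charts_at N p)"


subsection \<open>Riemannian manifolds\<close>

definition metric_in ::
    "('p, 'a::euclidean_space) riemannian \<Rightarrow> ('p, 'a) chart \<Rightarrow> 'a \<Rightarrow> 'a \<Rightarrow> 'a \<Rightarrow> real" where
  "metric_in N c x u v =
     metric N (chart_inv c x) (coord_vector N (chart_inv c x) c u) (coord_vector N (chart_inv c x) c v)"

definition riemannian_manifold :: "('p, 'a::euclidean_space) riemannian \<Rightarrow> bool" where
  "riemannian_manifold N \<longleftrightarrow> smooth_manifold (top_of N) (atlas N) \<and>
     (\<forall>c\<in>atlas N.
        (\<forall>u v. smooth_on (snd c ` fst c) (\<lambda>x. metric_in N c x u v)) \<and>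
        (\<forall>x\<in>snd c ` fst c. bilinear (metric_in N c x) \<and>
           (\<forall>u v. metric_in N c x u v = metric_in N c x v u) \<and>
           (\<forall>u. u \<noteq> 0 \<longrightarrow> metric_in N c x u u > 0)))"

definition orthonormal_system ::
    "('p, 'a::euclidean_space) riemannian \<Rightarrow> 'p \<Rightarrow> nat \<Rightarrow>
     ('p, 'a) tangent_vector \<Rightarrow> (nat \<Rightarrow> ('p, 'a) tangent_vector) \<Rightarrow> bool" where
  "orthonormal_system N p k u e \<longleftrightarrow>
     u \<in> tangent_space N p \<and> metric N p u u = 1 \<and>
     (\<forall>i\<in>{1..k}. e i \<in> tangent_space N p \<and> metric N p u (e i) = 0 \<and>
        (\<forall>j\<in>{1..k}. metric N p (e i) (e j) = (if i = j then 1 else 0)))"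


subsection \<open>Curvature\<close>

text \<open>First in a chart: \<open>G\<close> is a metric, and \<open>X\<close>, \<open>Y\<close>, \<open>Z\<close> are vector fields, on an open subset of
  the Euclidean space. The Levi-Civita connection is the covariant derivative of \<open>Y\<close> along \<open>X\<close>
  given by \<open>DY(X) + \<Gamma>(X, Y)\<close>, where the Christoffel symbol \<open>\<Gamma>\<close> is the unique one for which the
  connection is torsion-free (\<open>\<Gamma>\<close> is symmetric) and compatible with the metric.\<close>

definition christoffel :: "('a::euclidean_space \<Rightarrow> 'a \<Rightarrow> 'a \<Rightarrow> real) \<Rightarrow> 'a \<Rightarrow> 'a \<Rightarrow> 'a \<Rightarrow> 'a" where
  "christoffel G x = (THE \<Gamma>. bilinear \<Gamma> \<and> (\<forall>u v. \<Gamma> u v = \<Gamma> v u) \<and>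
     (\<forall>u v w. frechet_derivative (\<lambda>y. G y u v) (at x) w = G x (\<Gamma> w u) v + G x u (\<Gamma> w v)))"

definition levi_civita ::
    "('a::euclidean_space \<Rightarrow> 'a \<Rightarrow> 'a \<Rightarrow> real) \<Rightarrow> ('a \<Rightarrow> 'a) \<Rightarrow> ('a \<Rightarrow> 'a) \<Rightarrow> 'a \<Rightarrow> 'a" where
  "levi_civita G X Y = (\<lambda>x. frechet_derivative Y (at x) (X x) + christoffel G x (X x) (Y x))"

definition lie_bracket :: "('a::euclidean_space \<Rightarrow> 'a) \<Rightarrow> ('a \<Rightarrow> 'a) \<Rightarrow> 'a \<Rightarrow> 'a" where
  "lie_bracket X Y = (\<lambda>x. frechet_derivative Y (at x) (X x) - frechet_derivative X (at x) (Y x))"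

definition curvature_operator ::
    "('a::euclidean_space \<Rightarrow> 'a \<Rightarrow> 'a \<Rightarrow> real) \<Rightarrow> ('a \<Rightarrow> 'a) \<Rightarrow> ('a \<Rightarrow> 'a) \<Rightarrow> ('a \<Rightarrow> 'a) \<Rightarrow> 'a \<Rightarrow> 'a" where
  "curvature_operator G X Y Z = (\<lambda>x.
     levi_civita G X (levi_civita G Y Z) x - levi_civita G Y (levi_civita G X Z) x
     - levi_civita G (lie_bracket X Y) Z x)"

text \<open>The curvature tensor on \<open>T\<^sub>pN\<close>: the vectors are extended to vector fields with constant
  coordinates in a chart. The curvature being tensorial, neither the chart nor the choice of the
  extensions matters. The sign convention makes round spheres positively curved.\<close>

definition riemann_tensor ::
    "('p, 'a::euclidean_space) riemannian \<Rightarrow> 'p \<Rightarrow> ('p, 'a) tangent_vector \<Rightarrow>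
     ('p, 'a) tangent_vector \<Rightarrow> ('p, 'a) tangent_vector \<Rightarrow> ('p, 'a) tangent_vector" where
  "riemann_tensor N p x y z = (let c = chart_at N p in coord_vector N p c
     (curvature_operator (metric_in N c) (\<lambda>_. x c) (\<lambda>_. y c) (\<lambda>_. z c) (snd c p)))"

definition sec ::
    "('p, 'a::euclidean_space) riemannian \<Rightarrow> 'p \<Rightarrow> ('p, 'a) tangent_vector \<Rightarrow>
     ('p, 'a) tangent_vector \<Rightarrow> real" where
  "sec N p x y = metric N p (riemann_tensor N p x y y) x /
     (metric N p x x * metric N p y y - (metric N p x y)\<^sup>2)"

definition Ric_nonpos_at :: "('p, 'a::euclidean_space) riemannian \<Rightarrow> nat \<Rightarrow> 'p \<Rightarrow> bool" where
  "Ric_nonpos_at N k p \<longleftrightarrow>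
     (\<forall>u e. orthonormal_system N p k u e \<longrightarrow> (\<Sum>i=1..k. sec N p u (e i)) \<le> 0)"


subsection \<open>Isometric immersions\<close>

definition smooth_map ::
    "('p, 'a::euclidean_space) riemannian \<Rightarrow> ('q, 'b::euclidean_space) riemannian \<Rightarrow> ('p \<Rightarrow> 'q) \<Rightarrow> bool" where
  "smooth_map N M f \<longleftrightarrow> continuous_map (top_of N) (top_of M) f \<and>
     (\<forall>c\<in>atlas N. \<forall>d\<in>atlas M.
        smooth_on (snd c ` (fst c \<inter> f -` fst d)) (snd d \<circ> f \<circ> chart_inv c))"

text \<open>The differential of \<open>f\<close> at \<open>p\<close>; by the chain rule it does not depend on the chart chosen
  around \<open>p\<close>.\<close>

definition differential ::
    "('p, 'a::euclidean_space) riemannian \<Rightarrow> ('q, 'b::euclidean_space) riemannian \<Rightarrow> ('p \<Rightarrow> 'q) \<Rightarrow>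
     'p \<Rightarrow> ('p, 'a) tangent_vector \<Rightarrow> ('q, 'b) tangent_vector" where
  "differential N M f p v = (\<lambda>d. if d \<in> charts_at M (f p) then
     (let c = chart_at N p in
        frechet_derivative (snd d \<circ> f \<circ> chart_inv c) (at (snd c p)) (v c)) else 0)"

definition isometric_immersion ::
    "('p, 'a::euclidean_space) riemannian \<Rightarrow> ('q, 'b::euclidean_space) riemannian \<Rightarrow> ('p \<Rightarrow> 'q) \<Rightarrow> bool" where
  "isometric_immersion N M f \<longleftrightarrow> smooth_map N M f \<and>
     (\<forall>p\<in>topspace (top_of N).
        inj_on (differential N M f p) (tangent_space N p) \<and>
        (\<forall>v\<in>tangent_space N p. \<forall>w\<in>tangent_space N p.
           metric M (f p) (differential N M f p v) (differential N M f p w) = metric N p v w))"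

end

theory Submission
  imports Defs
begin

text \<open>In charts \<open>c\<close> around \<open>p\<close> and \<open>d\<close> around \<open>f p\<close>, the immersion is a smooth map \<open>F\<close> between open sets,
  with second fundamental form \<open>\<beta>\<close>, and the Gauss equation says that
  \<open>sec\<^sub>M(F\<^sub>*u, F\<^sub>*e) = sec\<^sub>N(u, e) - \<langle>\<beta>(u,u), \<beta>(e,e)\<rangle> + |\<beta>(u,e)|\<^sup>2\<close> for orthonormal \<open>u, e\<close>.
  Let the unit vector \<open>u\<close> minimise \<open>|\<beta>(u,u)|\<close>. The vectors \<open>e \<bottom> u\<close> with \<open>\<beta>(u,e) = 0\<close> form a space of
  dimension at least \<open>dim N - 1 - (dim M - dim N)\<close>, and minimality gives \<open>\<langle>\<beta>(u,u), \<beta>(e,e)\<rangle> \<ge> 0\<close> for them.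
  If \<open>2 dim N > dim M + k\<close>, this space contains orthonormal \<open>e\<^sub>1, \<dots>, e\<^sub>k\<close>, and then
  \<open>\<Sum> sec\<^sub>M(F\<^sub>*u, F\<^sub>*e\<^sub>i) \<le> \<Sum> sec\<^sub>N(u, e\<^sub>i) \<le> 0\<close>, a contradiction.\<close>

subsection \<open>Calculus in Euclidean spaces\<close>

lemma second_difference_mvt:
  fixes \<phi> :: "'a::real_normed_vector \<Rightarrow> real"
  assumes "t > 0" and sub: "\<And>r s. r \<in> {0..t} \<Longrightarrow> s \<in> {0..t} \<Longrightarrow> x + s *\<^sub>R v + r *\<^sub>R w \<in> S"
    and \<phi>: "\<And>y. y \<in> S \<Longrightarrow> (\<phi> has_derivative \<phi>' y) (at y)"
    and P: "\<And>y. y \<in> S \<Longrightarrow> ((\<lambda>z. \<phi>' z v) has_derivative P y) (at y)"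
  obtains r s where "r \<in> {0..t}" "s \<in> {0..t}"
    "\<phi> (x + t *\<^sub>R v + t *\<^sub>R w) - \<phi> (x + t *\<^sub>R v) - \<phi> (x + t *\<^sub>R w) + \<phi> x
       = t * t * P (x + s *\<^sub>R v + r *\<^sub>R w) w"
proof -
  \<comment> \<open>The second difference is \<open>f t - f 0\<close>. The mean value theorem in the
    direction \<open>v\<close> turns it into a difference of values of \<open>\<phi>'\<close> at
    \<open>v\<close>, and a second application in the direction \<open>w\<close> produces
    \<open>P\<close>.\<close>
  define f where "f s = \<phi> (x + s *\<^sub>R v + t *\<^sub>R w) - \<phi> (x + s *\<^sub>R v)" for s
  have f: "(f has_derivative (\<lambda>h. \<phi>' (x + s *\<^sub>R v + t *\<^sub>R w) (h *\<^sub>R v) - \<phi>' (x + s *\<^sub>R v) (h *\<^sub>R v)))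
      (at s within {0..t})" if "0 \<le> s" "s \<le> t" for s
  proof -
    have 1: "x + s *\<^sub>R v + t *\<^sub>R w \<in> S" "x + s *\<^sub>R v \<in> S"
      using sub[of t s] sub[of 0 s] that by auto
    have "((\<lambda>s. x + s *\<^sub>R v + t *\<^sub>R w) has_derivative (\<lambda>h. h *\<^sub>R v)) (at s within {0..t})"
      "((\<lambda>s. x + s *\<^sub>R v) has_derivative (\<lambda>h. h *\<^sub>R v)) (at s within {0..t})"
      by (auto intro!: derivative_eq_intros)
    from has_derivative_compose[OF this(1) \<phi>[OF 1(1)]] has_derivative_compose[OF this(2) \<phi>[OF 1(2)]]
    show ?thesis unfolding f_def by (rule has_derivative_diff)
  qed
  obtain s where s: "s \<in> {0<..<t}" and
    fs: "f t - f 0 = \<phi>' (x + s *\<^sub>R v + t *\<^sub>R w) ((t - 0) *\<^sub>R v) - \<phi>' (x + s *\<^sub>R v) ((t - 0) *\<^sub>R v)"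
    using mvt_simple[OF \<open>t > 0\<close> f] by blast
  define g where "g r = \<phi>' (x + s *\<^sub>R v + r *\<^sub>R w) v" for r
  have g: "(g has_derivative (\<lambda>h. P (x + s *\<^sub>R v + r *\<^sub>R w) (h *\<^sub>R w))) (at r within {0..t})"
    if "0 \<le> r" "r \<le> t" for r
  proof -
    have 1: "x + s *\<^sub>R v + r *\<^sub>R w \<in> S" using sub[of r s] that s by auto
    have "((\<lambda>r. x + s *\<^sub>R v + r *\<^sub>R w) has_derivative (\<lambda>h. h *\<^sub>R w)) (at r within {0..t})"
      by (auto intro!: derivative_eq_intros)
    from has_derivative_compose[OF this P[OF 1]] show ?thesis unfolding g_def .
  qed
  obtain r where r: "r \<in> {0<..<t}" and gr: "g t - g 0 = P (x + s *\<^sub>R v + r *\<^sub>R w) ((t - 0) *\<^sub>R w)"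
    using mvt_simple[OF \<open>t > 0\<close> g] by blast
  have S: "x + s *\<^sub>R v + t *\<^sub>R w \<in> S" "x + s *\<^sub>R v \<in> S" "x + s *\<^sub>R v + r *\<^sub>R w \<in> S"
    using sub[of t s] sub[of 0 s] sub[of r s] s r by auto
  note lin = linear_scale[OF has_derivative_linear]
  have "f t - f 0 = t * (g t - g 0)"
    using fs lin[OF \<phi>[OF S(1)]] lin[OF \<phi>[OF S(2)]] by (simp add: g_def right_diff_distrib)
  also have "g t - g 0 = t * P (x + s *\<^sub>R v + r *\<^sub>R w) w"
    using gr lin[OF P[OF S(3)]] by simp
  finally show ?thesis
    using that[of r s] r s by (simp add: f_def)
qed

text \<open>The second difference over a small parallelogram is symmetric in \<open>v\<close> and
  \<open>w\<close>. Expanding it in both orders and cancelling \<open>t * t\<close> gives a value of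
  \<open>P\<close> equal to a value of \<open>Q\<close>, both taken at points near \<open>x\<close>;
  continuity does the rest.\<close>

lemma second_derivative_symmetric_real:
  fixes \<phi> :: "'a::real_normed_vector \<Rightarrow> real"
  assumes "open S" "x \<in> S"
    and \<phi>: "\<And>y. y \<in> S \<Longrightarrow> (\<phi> has_derivative \<phi>' y) (at y)"
    and P: "\<And>y. y \<in> S \<Longrightarrow> ((\<lambda>z. \<phi>' z v) has_derivative P y) (at y)"
    and Q: "\<And>y. y \<in> S \<Longrightarrow> ((\<lambda>z. \<phi>' z w) has_derivative Q y) (at y)"
    and cP: "continuous (at x) (\<lambda>y. P y w)" and cQ: "continuous (at x) (\<lambda>y. Q y v)"
  shows "P x w = Q x v"
proof -
  have "\<bar>P x w - Q x v\<bar> \<le> e" if "e > 0" for e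
  proof -
    obtain d where d: "d > 0" "ball x d \<subseteq> S" 
      using assms(1,2) open_contains_ball by blast
    obtain d1 where d1: "d1 > 0" "\<And>y. dist y x < d1 \<Longrightarrow> dist (P y w) (P x w) < e/2"
      using cP \<open>e > 0\<close> unfolding continuous_at_eps_delta by (metis half_gt_zero)
    obtain d2 where d2: "d2 > 0" "\<And>y. dist y x < d2 \<Longrightarrow> dist (Q y v) (Q x v) < e/2"
      using cQ \<open>e > 0\<close> unfolding continuous_at_eps_delta by (metis half_gt_zero)
    define m where "m = min d (min d1 d2)"
    \<comment> \<open>This side length keeps the whole parallelogram within distance
      \<open>m\<close> of \<open>x\<close>; the summand 1 excludes a zero denominator and makes the
      estimate strict.\<close>
    define t where "t = m / (norm v + norm w + 1)"
    have m: "m > 0" "m \<le> d" "m \<le> d1" "m \<le> d2" using d d1 d2 by (auto simp: m_def)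
    have n: "norm v + norm w + 1 > 0"
      by (simp add: add.commute add_pos_nonneg)
    have t: "t > 0" using m n by (simp add: t_def)
    have tm: "t * (norm v + norm w + 1) = m" using n by (simp add: t_def)
    have close: "dist (x + s *\<^sub>R v + r *\<^sub>R w) x < m" if "r \<in> {0..t}" "s \<in> {0..t}" for r s
    proof -
      have "dist (x + s *\<^sub>R v + r *\<^sub>R w) x = norm (s *\<^sub>R v + r *\<^sub>R w)" by (simp add: dist_norm)
      also have "\<dots> \<le> s * norm v + r * norm w"
        using norm_triangle_ineq[of "s *\<^sub>R v" "r *\<^sub>R w"] that by simp
      also have "\<dots> \<le> t * norm v + t * norm w"
        using that by (intro add_mono mult_right_mono) auto
      also have "\<dots> < m" using tm t by (simp add: algebra_simps)
      finally show ?thesis .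
    qed
    have inS: "x + s *\<^sub>R v + r *\<^sub>R w \<in> S" if "r \<in> {0..t}" "s \<in> {0..t}" for r s
      using close[OF that] m d by (auto simp: dist_commute)
    have inS': "x + s *\<^sub>R w + r *\<^sub>R v \<in> S" if "r \<in> {0..t}" "s \<in> {0..t}" for r s
      using inS[OF that(2,1)] by (simp add: algebra_simps)
    obtain r s where rs: "r \<in> {0..t}" "s \<in> {0..t}"
      "\<phi> (x + t *\<^sub>R v + t *\<^sub>R w) - \<phi> (x + t *\<^sub>R v) - \<phi> (x + t *\<^sub>R w) + \<phi> x
       = t * t * P (x + s *\<^sub>R v + r *\<^sub>R w) w"
      using second_difference_mvt[OF t inS \<phi> P] by blast
    obtain r' s' where rs': "r' \<in> {0..t}" "s' \<in> {0..t}"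
      "\<phi> (x + t *\<^sub>R w + t *\<^sub>R v) - \<phi> (x + t *\<^sub>R w) - \<phi> (x + t *\<^sub>R v) + \<phi> x
       = t * t * Q (x + s' *\<^sub>R w + r' *\<^sub>R v) v"
      using second_difference_mvt[OF t inS' \<phi> Q] by blast
    have "t * t * P (x + s *\<^sub>R v + r *\<^sub>R w) w = t * t * Q (x + s' *\<^sub>R w + r' *\<^sub>R v) v"
      using rs(3) rs'(3) by (simp add: algebra_simps)
    hence "P (x + s *\<^sub>R v + r *\<^sub>R w) w = Q (x + s' *\<^sub>R w + r' *\<^sub>R v) v" using t by simp
    moreover have "dist (P (x + s *\<^sub>R v + r *\<^sub>R w) w) (P x w) < e/2"
      using d1(2) close[OF rs(1,2)] m by simp
    moreover have "dist (Q (x + s' *\<^sub>R w + r' *\<^sub>R v) v) (Q x v) < e/2"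
      using d2(2) close[OF rs'(2,1)] m by (simp add: algebra_simps)
    ultimately show ?thesis by (simp add: dist_real_def abs_real_def split: if_splits)
  qed
  hence "\<bar>P x w - Q x v\<bar> \<le> 0" by (rule field_le_epsilon[of _ 0, simplified])
  thus ?thesis by simp
qed

lemma second_derivative_symmetric:
  fixes \<phi> :: "'a::real_normed_vector \<Rightarrow> 'b::euclidean_space"
  assumes "open S" "x \<in> S"
    and \<phi>: "\<And>y. y \<in> S \<Longrightarrow> (\<phi> has_derivative \<phi>' y) (at y)"
    and P: "\<And>y. y \<in> S \<Longrightarrow> ((\<lambda>z. \<phi>' z v) has_derivative P y) (at y)"
    and Q: "\<And>y. y \<in> S \<Longrightarrow> ((\<lambda>z. \<phi>' z w) has_derivative Q y) (at y)"
    and cP: "continuous (at x) (\<lambda>y. P y w)" and cQ: "continuous (at x) (\<lambda>y. Q y v)"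
  shows "P x w = Q x v"
proof (rule euclidean_eqI)
  fix b :: 'b
  show "P x w \<bullet> b = Q x v \<bullet> b"
    using assms
    by (intro second_derivative_symmetric_real[where S = S and x = x and \<phi> = "\<lambda>y. \<phi> y \<bullet> b"
          and \<phi>' = "\<lambda>y h. \<phi>' y h \<bullet> b" and P = "\<lambda>y h. P y h \<bullet> b" and Q = "\<lambda>y h. Q y h \<bullet> b"])
      (auto intro!: has_derivative_inner_left continuous_intros)
qed

section \<open>Derivatives of smooth functions\<close>

lemma smooth_on_has_derivative:
  "smooth_on S f \<Longrightarrow> x \<in> S \<Longrightarrow> (f has_derivative frechet_derivative f (at x)) (at x)"
  unfolding smooth_on_def using Ck_on.simps(2)[of 0 S f] frechet_derivative_works by blast

lemma smooth_on_frechet_derivative: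
  "smooth_on S f \<Longrightarrow> smooth_on S (\<lambda>x. frechet_derivative f (at x) v)"
  unfolding smooth_on_def by (metis Ck_on.simps(2))

lemma smooth_on_imp_continuous:
  "smooth_on S f \<Longrightarrow> open S \<Longrightarrow> x \<in> S \<Longrightarrow> continuous (at x) f"
  unfolding smooth_on_def by (metis Ck_on.simps(1) continuous_on_eq_continuous_at)

lemma smooth_on_frechet_derivative_commute:
  fixes f :: "'a::euclidean_space \<Rightarrow> 'b::euclidean_space"
  assumes "smooth_on S f" "open S" "x \<in> S"
  shows "frechet_derivative (\<lambda>y. frechet_derivative f (at y) v) (at x) w =
    frechet_derivative (\<lambda>y. frechet_derivative f (at y) w) (at x) v"
  by (rule second_derivative_symmetric[OF assms(2,3) smooth_on_has_derivative[OF assms(1)]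
        smooth_on_has_derivative[OF smooth_on_frechet_derivative[OF assms(1)]]
        smooth_on_has_derivative[OF smooth_on_frechet_derivative[OF assms(1)]]])
    (auto intro!: smooth_on_imp_continuous smooth_on_frechet_derivative assms)

section \<open>Product rules and inverses for families of linear maps\<close>

lemma has_derivative_linear_family:
  fixes T :: "'x::real_normed_vector \<Rightarrow> 'a::euclidean_space \<Rightarrow> 'c::real_normed_vector"
  assumes lin: "\<forall>\<^sub>F x in nhds x0. linear (T x)"
    and T: "\<And>u. ((\<lambda>x. T x u) has_derivative (\<lambda>h. T' h u)) (at x0)"
    and A: "(A has_derivative A') (at x0)"
  shows "((\<lambda>x. T x (A x)) has_derivative (\<lambda>h. T' h (A x0) + T x0 (A' h))) (at x0)"
proof -
  have lin0: "linear (T x0)" using lin by (rule eventually_nhds_x_imp_x)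
  have expand: "(\<Sum>i\<in>Basis. (a \<bullet> i) *\<^sub>R L i) = L a" if "linear L" for L :: "'a \<Rightarrow> 'c" and a
    using linear_sum[OF that, of "\<lambda>i. (a \<bullet> i) *\<^sub>R i" Basis]
    by (simp add: linear_scale[OF that] euclidean_representation)
  \<comment> \<open>Expanding \<open>A x - A x0\<close> in the basis leaves finitely many products
    of differentiable functions. Their scalar factors vanish at \<open>x0\<close>, so the
    derivatives of the \<open>T x i\<close> contribute nothing to the sum.\<close>
  have "((\<lambda>x. T x (A x0) + (\<Sum>i\<in>Basis. ((A x - A x0) \<bullet> i) *\<^sub>R T x i)) has_derivative
      (\<lambda>h. T' h (A x0) + (\<Sum>i\<in>Basis. (A' h \<bullet> i) *\<^sub>R T x0 i))) (at x0)"
    by (rule derivative_eq_intros T A refl | simp)+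
  hence "((\<lambda>x. T x (A x0) + (\<Sum>i\<in>Basis. ((A x - A x0) \<bullet> i) *\<^sub>R T x i)) has_derivative
      (\<lambda>h. T' h (A x0) + T x0 (A' h))) (at x0)"
    by (simp add: expand[OF lin0])
  moreover have "\<forall>\<^sub>F x in at x0. T x (A x0) + (\<Sum>i\<in>Basis. ((A x - A x0) \<bullet> i) *\<^sub>R T x i) = T x (A x)"
    using eventually_nhds_conv_at[THEN iffD1, OF lin, THEN conjunct1]
    by eventually_elim (simp only: expand, simp add: linear_diff)
  ultimately show ?thesis
    by (rule has_derivative_transform_eventually) (simp_all)
qed

lemma has_derivative_bilinear_family:
  fixes G :: "'x::real_normed_vector \<Rightarrow> 'a::euclidean_space \<Rightarrow> 'b::euclidean_space \<Rightarrow> 'c::real_normed_vector"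
  assumes bil: "\<forall>\<^sub>F x in nhds x0. bilinear (G x)"
    and G: "\<And>u v. ((\<lambda>x. G x u v) has_derivative (\<lambda>h. G' h u v)) (at x0)"
    and A: "(A has_derivative A') (at x0)" and B: "(B has_derivative B') (at x0)"
  shows "((\<lambda>x. G x (A x) (B x)) has_derivative
    (\<lambda>h. G' h (A x0) (B x0) + G x0 (A' h) (B x0) + G x0 (A x0) (B' h))) (at x0)"
proof (rule has_derivative_linear_family[where T = "\<lambda>x. G x (A x)"
      and T' = "\<lambda>h v. G' h (A x0) v + G x0 (A' h) v", OF _ _ B])
  show "\<forall>\<^sub>F x in nhds x0. linear (G x (A x))"
    using bil by eventually_elim (simp add: bilinear_def)
  show "((\<lambda>x. G x (A x) v) has_derivative (\<lambda>h. G' h (A x0) v + G x0 (A' h) v)) (at x0)" for v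
  proof (rule has_derivative_linear_family[where T = "\<lambda>x u. G x u v" and T' = "\<lambda>h u. G' h u v", OF _ G A])
    show "\<forall>\<^sub>F x in nhds x0. linear (\<lambda>u. G x u v)"
      using bil by eventually_elim (simp add: bilinear_def)
  qed
qed

text \<open>Continuity of \<open>g\<close> suffices because \<open>f\<close> vanishes at
  \<open>x0\<close>: the extra error \<open>(g x - g x0) *\<^sub>R f' (x - x0)\<close> is of smaller
  order than \<open>x - x0\<close>. Below, this applies to a factor so far known only to be
  continuous.\<close>

lemma has_derivative_scaleR_vanishing:
  fixes g :: "'x::real_normed_vector \<Rightarrow> real" and f :: "'x \<Rightarrow> 'c::real_normed_vector"
  assumes f: "(f has_derivative f') (at x0)" and "f x0 = 0" and g: "continuous (at x0) g"
  shows "((\<lambda>x. g x *\<^sub>R f x) has_derivative (\<lambda>h. g x0 *\<^sub>R f' h)) (at x0)"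
proof -
  have fl: "bounded_linear f'" using f by (rule has_derivative_bounded_linear)
  have g0: "((\<lambda>x. g x - g x0) \<longlongrightarrow> 0) (at x0)"
    using g by (simp add: continuous_at LIM_zero_iff)
  obtain K where K: "\<And>h. norm (f' h) \<le> norm h * K"
    using bounded_linear.bounded[OF fl] by blast
  have lim: "((\<lambda>x. norm (f x - f x0 - f' (x - x0)) / norm (x - x0)) \<longlongrightarrow> 0) (at x0)"
    using f by (auto simp: has_derivative_iff_norm)
  have "((\<lambda>x. \<bar>g x\<bar> * (norm (f x - f x0 - f' (x - x0)) / norm (x - x0)) + \<bar>g x - g x0\<bar> * K) \<longlongrightarrow>
      \<bar>g x0\<bar> * 0 + \<bar>0\<bar> * K) (at x0)"
    using g by (intro tendsto_intros lim g0) (simp_all add: continuous_at)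
  hence lim': "((\<lambda>x. \<bar>g x\<bar> * (norm (f x - f x0 - f' (x - x0)) / norm (x - x0)) + \<bar>g x - g x0\<bar> * K)
      \<longlongrightarrow> 0) (at x0)" by simp
  have "((\<lambda>x. norm (g x *\<^sub>R f x - g x0 *\<^sub>R f x0 - g x0 *\<^sub>R f' (x - x0)) / norm (x - x0)) \<longlongrightarrow> 0) (at x0)"
  proof (rule Lim_null_comparison[OF _ lim'], rule eventually_at_filter[THEN iffD2], rule always_eventually, intro allI impI)
    fix x assume x: "x \<noteq> x0"
    have "g x *\<^sub>R f x - g x0 *\<^sub>R f x0 - g x0 *\<^sub>R f' (x - x0) =
        g x *\<^sub>R (f x - f x0 - f' (x - x0)) + (g x - g x0) *\<^sub>R f' (x - x0)"
      using \<open>f x0 = 0\<close> by (simp add: algebra_simps)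
    hence "norm (g x *\<^sub>R f x - g x0 *\<^sub>R f x0 - g x0 *\<^sub>R f' (x - x0)) \<le>
        \<bar>g x\<bar> * norm (f x - f x0 - f' (x - x0)) + \<bar>g x - g x0\<bar> * norm (f' (x - x0))"
      by (metis norm_scaleR norm_triangle_ineq)
    also have "\<dots> \<le> \<bar>g x\<bar> * norm (f x - f x0 - f' (x - x0)) + \<bar>g x - g x0\<bar> * (norm (x - x0) * K)"
      by (intro add_left_mono mult_left_mono K) auto
    finally show "norm (norm (g x *\<^sub>R f x - g x0 *\<^sub>R f x0 - g x0 *\<^sub>R f' (x - x0)) / norm (x - x0)) \<le>
       \<bar>g x\<bar> * (norm (f x - f x0 - f' (x - x0)) / norm (x - x0)) + \<bar>g x - g x0\<bar> * K"
      using x by (simp add: field_simps)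
  qed
  moreover have "bounded_linear (\<lambda>h. g x0 *\<^sub>R f' h)"
    using fl by (rule bounded_linear_const_scaleR)
  ultimately show ?thesis by (simp add: has_derivative_iff_norm)
qed

text \<open>Differentiability of \<open>T(x)\<^sup>-\<^sup>1\<close>, without operator norms: \<open>h\<close> is first shown to be bounded
  near \<open>x0\<close>, then continuous, then differentiable, always from the same fixed point equation.\<close>

lemma differentiable_linear_solution:
  fixes T :: "'x::real_normed_vector \<Rightarrow> 'a::euclidean_space \<Rightarrow> 'a"
  assumes lin: "\<forall>\<^sub>F x in nhds x0. linear (T x)" and inj: "inj (T x0)"
    and T: "\<And>u. (\<lambda>x. T x u) differentiable (at x0)"
    and Th: "(\<lambda>x. T x (h x)) differentiable (at x0)"
  shows "h differentiable (at x0)"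
proof -
  have lin0: "linear (T x0)" using lin by (rule eventually_nhds_x_imp_x)
  obtain L where L: "linear L" "\<And>v. L (T x0 v) = v"
    using linear_injective_left_inverse[OF lin0 inj] by (metis comp_apply id_apply)
  have bl: "bounded_linear L" using L(1) by (simp add: linear_conv_bounded_linear)
  \<comment> \<open>\<open>L\<close> inverts \<open>T x0\<close>, so \<open>r i\<close> is the error
    of \<open>L\<close> as a left inverse of \<open>T x\<close> on the basis vector
    \<open>i\<close>; it vanishes at \<open>x0\<close>.\<close>
  define r where "r i x = L (T x i) - i" for i x
  define j where "j x = L (T x (h x))" for x
  have r: "r i differentiable (at x0)" for i
    unfolding r_def
    using differentiable_compose[OF linear_imp_differentiable[OF L(1)] T] by (auto intro: derivative_intros)
  have r0: "r i x0 = 0" for i by (simp add: r_def L)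
  have j: "j differentiable (at x0)"
    unfolding j_def using differentiable_compose[OF linear_imp_differentiable[OF L(1)] Th] .
  have fix_eq: "h x = j x - (\<Sum>i\<in>Basis. (h x \<bullet> i) *\<^sub>R r i x)" if "linear (T x)" for x
  proof -
    have l: "linear (\<lambda>v. L (T x v) - v)"
      using linear_compose_sub[OF linear_compose[OF that L(1)] linear_ident] by (simp add: o_def)
    have "(\<Sum>i\<in>Basis. (h x \<bullet> i) *\<^sub>R r i x) = L (T x (h x)) - h x"
      using linear_sum[OF l, of "\<lambda>i. (h x \<bullet> i) *\<^sub>R i" Basis]
      by (simp add: linear_scale[OF l] euclidean_representation r_def)
    thus ?thesis by (simp add: j_def)
  qed
  define \<eta> where "\<eta> x = (\<Sum>i\<in>Basis. norm (r i x))" for x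
  have contr: "continuous (at x0) (r i)" for i using r by (rule differentiable_imp_continuous_within)
  have contj: "continuous (at x0) j" using j by (rule differentiable_imp_continuous_within)
  have \<eta>0: "(\<eta> \<longlongrightarrow> 0) (at x0)"
  proof -
    have "(\<eta> \<longlongrightarrow> (\<Sum>i\<in>(Basis::'a set). norm (r i x0))) (at x0)"
      unfolding \<eta>_def by (intro tendsto_intros contr[unfolded continuous_at])
    thus ?thesis by (simp add: r0)
  qed
  have bound: "norm (h x - j x) \<le> norm (h x) * \<eta> x" if "linear (T x)" for x
  proof -
    have "norm (h x - j x) = norm (\<Sum>i\<in>Basis. (h x \<bullet> i) *\<^sub>R r i x)"
      by (subst fix_eq[OF that]) (simp del: norm_sum)
    also have "\<dots> \<le> (\<Sum>i\<in>Basis. norm (h x) * norm (r i x))"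
      by (rule sum_norm_le) (auto intro!: mult_right_mono simp: Basis_le_norm)
    finally show ?thesis by (simp add: \<eta>_def sum_distrib_left)
  qed
  have lin': "\<forall>\<^sub>F x in at x0. linear (T x)" using lin by (simp add: eventually_nhds_conv_at)
  have small: "\<forall>\<^sub>F x in at x0. \<eta> x < 1/2"
    using \<eta>0 by (rule order_tendstoD) simp
  have "((\<lambda>x. h x - j x) \<longlongrightarrow> 0) (at x0)"
  proof (rule Lim_null_comparison)
    show "\<forall>\<^sub>F x in at x0. norm (h x - j x) \<le> 2 * norm (j x) * \<eta> x"
      using lin' small
    proof eventually_elim
      case (elim x)
      have "\<eta> x \<ge> 0" by (simp add: \<eta>_def sum_nonneg)
      \<comment> \<open>Since \<open>\<eta> x < 1/2\<close>, the term in \<open>norm (h x)\<close>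
        on the right is absorbed on the left, which bounds \<open>h\<close> by
        \<open>2 * norm (j x)\<close>.\<close>
      have "norm (h x) \<le> norm (j x) + norm (h x - j x)"
        by (metis add.commute diff_add_cancel norm_triangle_ineq)
      also have "\<dots> \<le> norm (j x) + norm (h x) * (1/2)"
        using bound[OF elim(1)] mult_left_mono[OF less_imp_le[OF elim(2)], of "norm (h x)"] by simp
      finally have "norm (h x) \<le> 2 * norm (j x)" by simp
      thus ?case using bound[OF elim(1)] mult_right_mono[OF _ \<open>\<eta> x \<ge> 0\<close>] by force
    qed
    show "((\<lambda>x. 2 * norm (j x) * \<eta> x) \<longlongrightarrow> 0) (at x0)"
      using tendsto_mult[OF _ \<eta>0, of "\<lambda>x. 2 * norm (j x)" "2 * norm (j x0)"] contj
      by (simp add: continuous_at tendsto_mult_left tendsto_norm)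
  qed
  moreover have "h x0 = j x0" using fix_eq[OF lin0] by (simp add: r0)
  ultimately have "(h \<longlongrightarrow> h x0) (at x0)"
    using contj Lim_transform[of j "h x0" "at x0" h]  by (simp add: continuous_at)
  hence conth: "continuous (at x0) h" by (simp add: continuous_at)
  \<comment> \<open>\<open>h\<close> is now continuous and \<open>r i\<close> vanishes at
    \<open>x0\<close>, so the product is differentiable, and the fixed point equation passes this on
    to \<open>h\<close>.\<close>
  have "(\<lambda>x. (h x \<bullet> i) *\<^sub>R r i x) differentiable (at x0)" for i
    using has_derivative_scaleR_vanishing[OF frechet_derivative_works[THEN iffD1, OF r] r0, of "\<lambda>x. h x \<bullet> i"] conth
    unfolding differentiable_def by (auto intro: continuous_intros)
  hence "(\<lambda>x. j x - (\<Sum>i\<in>Basis. (h x \<bullet> i) *\<^sub>R r i x)) differentiable (at x0)"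
    using j by (intro differentiable_diff differentiable_sum) auto
  then obtain D where D: "((\<lambda>x. j x - (\<Sum>i\<in>Basis. (h x \<bullet> i) *\<^sub>R r i x)) has_derivative D) (at x0)"
    by (auto simp: differentiable_def)
  have "(h has_derivative D) (at x0)"
    using D by (rule has_derivative_transform_eventually)
      (use lin' fix_eq[OF lin0] in \<open>auto elim!: eventually_mono simp: fix_eq[symmetric]\<close>)
  thus ?thesis by (auto simp: differentiable_def)
qed

subsection \<open>The Levi-Civita connection and the Gauss equation in coordinates\<close>

definition riesz :: "('a::euclidean_space \<Rightarrow> 'a \<Rightarrow> real) \<Rightarrow> 'a \<Rightarrow> 'a" where
  "riesz g v = (\<Sum>j\<in>Basis. g v j *\<^sub>R j)"

lemma linear_riesz: "bilinear g \<Longrightarrow> linear (riesz g)"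
  unfolding riesz_def
  by (intro linearI) (simp_all add: bilinear_ladd bilinear_lmul algebra_simps sum.distrib scaleR_right.sum)

lemma inner_riesz: "bilinear g \<Longrightarrow> riesz g v \<bullet> w = g v w"
proof -
  assume "bilinear g"
  then have l: "linear (g v)" by (simp add: bilinear_def)
  have "riesz g v \<bullet> w = (\<Sum>j\<in>Basis. (w \<bullet> j) * g v j)"
    unfolding riesz_def inner_sum_left by (intro sum.cong) (simp_all add: inner_commute)
  also have "\<dots> = g v (\<Sum>j\<in>Basis. (w \<bullet> j) *\<^sub>R j)"
    by (simp add: linear_sum[OF l] linear_scale[OF l])
  finally show ?thesis by (simp add: euclidean_representation)
qed

lemma inj_riesz:
  fixes g :: "'a::euclidean_space \<Rightarrow> 'a \<Rightarrow> real"
  assumes "bilinear g" and "\<And>u. u \<noteq> 0 \<Longrightarrow> g u u > 0"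
  shows "inj (riesz g)"
proof (subst linear_injective_0[OF linear_riesz[OF assms(1)]], intro allI impI)
  fix u assume "riesz g u = 0"
  then have "g u u = 0" using inner_riesz[OF assms(1), of u u] by simp
  then show "u = 0" using assms(2)[of u] by fastforce
qed

text \<open>Definiteness makes \<open>riesz g\<close> injective, hence surjective in finite
  dimension; \<open>v\<close> is a preimage of the Euclidean representative of
  \<open>\<phi>\<close>.\<close>

lemma riesz_represent:
  fixes g :: "'a::euclidean_space \<Rightarrow> 'a \<Rightarrow> real"
  assumes "bilinear g" and "\<And>u. u \<noteq> 0 \<Longrightarrow> g u u > 0" and "linear \<phi>"
  obtains v where "\<And>w. g v w = \<phi> w"
proof -
  have "surj (riesz g)"
    using linear_injective_imp_surjective[OF linear_riesz inj_riesz] assms by blast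
  then obtain v where v: "riesz g v = (\<Sum>j\<in>Basis. \<phi> j *\<^sub>R j)" by (metis surjD)
  have "g v w = \<phi> w" for w
  proof -
    have "g v w = (\<Sum>j\<in>Basis. (w \<bullet> j) * \<phi> j)"
      unfolding inner_riesz[OF assms(1), symmetric] v inner_sum_left
      by (intro sum.cong) (simp_all add: inner_commute)
    also have "\<dots> = \<phi> (\<Sum>j\<in>Basis. (w \<bullet> j) *\<^sub>R j)"
      by (simp add: linear_sum[OF assms(3)] linear_scale[OF assms(3)])
    finally show ?thesis by (simp add: euclidean_representation)
  qed
  then show ?thesis by (rule that)
qed

section \<open>Levi-Civita connection and curvature of a metric on an open set\<close>

locale local_metric =
  fixes U :: "'a::euclidean_space set" and G :: "'a \<Rightarrow> 'a \<Rightarrow> 'a \<Rightarrow> real"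
  assumes open_U: "open U"
    and smooth: "\<And>u v. smooth_on U (\<lambda>x. G x u v)"
    and bil: "\<And>x. x \<in> U \<Longrightarrow> bilinear (G x)"
    and sym: "\<And>x u v. x \<in> U \<Longrightarrow> G x u v = G x v u"
    and pos: "\<And>x u. x \<in> U \<Longrightarrow> u \<noteq> 0 \<Longrightarrow> G x u u > 0"
begin

definition dG :: "'a \<Rightarrow> 'a \<Rightarrow> 'a \<Rightarrow> 'a \<Rightarrow> real" where
  "dG x w u v = frechet_derivative (\<lambda>y. G y u v) (at x) w"

lemma eventually_in_U:
  assumes "(f has_derivative f') (at x)" and "f x \<in> U"
  shows "\<forall>\<^sub>F y in nhds x. f y \<in> U"
proof -
  have "(f \<longlongrightarrow> f x) (nhds x)"
    using has_derivative_continuous[OF assms(1)] by (simp add: continuous_at tendsto_nhds_iff)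
  then show ?thesis using open_U assms(2) by (rule topological_tendstoD)
qed

lemma metric_eqI: "x \<in> U \<Longrightarrow> (\<And>w. G x v w = G x v' w) \<Longrightarrow> v = v'"
  using pos[of x "v - v'"] bilinear_lsub[OF bil[of x], of v v' "v - v'"] by fastforce

lemma has_derivative_G: "x \<in> U \<Longrightarrow> ((\<lambda>y. G y u v) has_derivative (\<lambda>w. dG x w u v)) (at x)"
  unfolding dG_def using smooth_on_has_derivative[OF smooth] .

lemma has_derivative_dG:
  "x \<in> U \<Longrightarrow> ((\<lambda>y. dG y w u v) has_derivative frechet_derivative (\<lambda>y. dG y w u v) (at x)) (at x)"
  unfolding dG_def using smooth_on_has_derivative[OF smooth_on_frechet_derivative[OF smooth]] .

lemma linear_dG_dir: "x \<in> U \<Longrightarrow> linear (\<lambda>w. dG x w u v)"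
  using has_derivative_linear[OF has_derivative_G] .

text \<open>By uniqueness of derivatives, identities for \<open>G\<close> on the open set
  \<open>U\<close> pass to \<open>dG\<close>. Symmetry and linearity of \<open>dG\<close> are
  obtained this way, and later the tangential part of the ambient derivative.\<close>

lemma dG_unique:
  assumes "x \<in> U" "(f has_derivative f') (at x)" "\<And>y. y \<in> U \<Longrightarrow> f y = G y u v"
  shows "dG x w u v = f' w"
proof -
  have "((\<lambda>y. G y u v) has_derivative f') (at x)"
    by (rule has_derivative_transform_within_open[OF assms(2) open_U assms(1,3)])
  from fun_cong[OF has_derivative_unique[OF has_derivative_G[OF assms(1)] this], of w] show ?thesis .
qed

lemma dG_sym: "x \<in> U \<Longrightarrow> dG x w u v = dG x w v u"
  by (rule dG_unique[OF _ has_derivative_G]) (auto simp: sym)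

lemma linear_dG: "x \<in> U \<Longrightarrow> linear (dG x w u)"
proof (rule linearI)
  assume x: "x \<in> U"
  show "dG x w u (a + b) = dG x w u a + dG x w u b" for a b
    by (rule dG_unique[OF x has_derivative_add[OF has_derivative_G[OF x] has_derivative_G[OF x]]])
      (simp add: bilinear_radd[OF bil])
  show "dG x w u (c *\<^sub>R a) = c *\<^sub>R dG x w u a" for a c
    by (rule dG_unique[OF x has_derivative_scaleR_right[OF has_derivative_G[OF x]]])
      (simp add: bilinear_rmul[OF bil])
qed

lemma dG_linear:
  assumes "x \<in> U"
  shows "dG x (a + b) u v = dG x a u v + dG x b u v" "dG x (c *\<^sub>R a) u v = c * dG x a u v"
    "dG x w u (a + b) = dG x w u a + dG x w u b" "dG x w u (c *\<^sub>R a) = c * dG x w u a"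
    "dG x w (a + b) v = dG x w a v + dG x w b v" "dG x w (c *\<^sub>R a) v = c * dG x w a v"
  using linear_add[OF linear_dG_dir[OF assms]] linear_scale[OF linear_dG_dir[OF assms]]
    linear_add[OF linear_dG[OF assms]] linear_scale[OF linear_dG[OF assms]]
  by (simp_all add: dG_sym[OF assms, of _ "_ + _" v] dG_sym[OF assms, of _ "_ *\<^sub>R _" v] dG_sym[OF assms, of w v])

text \<open>Koszul's formula for constant fields, whose brackets vanish: the Christoffel symbol of
  the first kind, that is, the metric product of the covariant derivative of \<open>v\<close> along
  \<open>u\<close> with \<open>w\<close>.\<close>

definition koszul :: "'a \<Rightarrow> 'a \<Rightarrow> 'a \<Rightarrow> 'a \<Rightarrow> real" where
  "koszul x u v w = (dG x u v w + dG x v u w - dG x w u v) / 2"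

lemma linear_koszul: "x \<in> U \<Longrightarrow> linear (koszul x u v)"
  by (intro linearI) (simp_all add: koszul_def dG_linear field_simps)

lemma koszul_sym: "x \<in> U \<Longrightarrow> koszul x u v w = koszul x v u w"
  by (simp add: koszul_def dG_sym[of x w])

lemma koszul_compat: "x \<in> U \<Longrightarrow> koszul x w u v + koszul x w v u = dG x w u v"
  using dG_sym[of x w u v] dG_sym[of x u w v] dG_sym[of x v w u] unfolding koszul_def by (simp add: field_simps)

text \<open>Substituting the compatibility relation for each of the three derivatives, symmetry
  cancels everything except two copies of \<open>K u v w\<close>.\<close>

lemma koszul_unique:
  assumes "x \<in> U" "\<And>u v w. K u v w = K v u w" "\<And>u v w. dG x w u v = K w u v + K w v u"
  shows "koszul x u v w = K u v w"
  unfolding koszul_def assms(3)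
  using assms(2)[of u v w] assms(2)[of u w v] assms(2)[of v w u] by simp

text \<open>The property under the description operator in \<open>christoffel\<close>, named so that
  its existence and uniqueness can be proved.\<close>

definition levi_civita_symbol :: "'a \<Rightarrow> ('a \<Rightarrow> 'a \<Rightarrow> 'a) \<Rightarrow> bool" where
  "levi_civita_symbol x \<Gamma> \<longleftrightarrow> bilinear \<Gamma> \<and> (\<forall>u v. \<Gamma> u v = \<Gamma> v u) \<and>
     (\<forall>u v w. frechet_derivative (\<lambda>y. G y u v) (at x) w = G x (\<Gamma> w u) v + G x u (\<Gamma> w v))"

lemma levi_civita_symbol_koszul:
  assumes x: "x \<in> U" and \<Gamma>: "levi_civita_symbol x \<Gamma>"
  shows "G x (\<Gamma> u v) w = koszul x u v w"
proof (rule koszul_unique[OF x, symmetric])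
  show "G x (\<Gamma> u v) w = G x (\<Gamma> v u) w" for u v w
    using \<Gamma> unfolding levi_civita_symbol_def by metis
  show "dG x w u v = G x (\<Gamma> w u) v + G x (\<Gamma> w v) u" for u v w
    using \<Gamma> sym[OF x, of u] by (simp add: dG_def levi_civita_symbol_def)
qed

text \<open>Riesz representation of the Koszul form gives existence. Every such symbol represents
  the Koszul form, so nondegeneracy of the metric gives uniqueness, and the definite description in
  \<open>christoffel\<close> denotes.\<close>

lemma levi_civita_symbol_christoffel:
  assumes x: "x \<in> U"
  shows "levi_civita_symbol x (christoffel G x)"
proof -
  have "\<exists>z. \<forall>w. G x z w = koszul x u v w" for u v
    by (rule riesz_represent[OF bil[OF x] pos[OF x] linear_koszul[OF x, of u v]]) blast+
  then obtain \<Gamma> where \<Gamma>: "\<And>u v w. G x (\<Gamma> u v) w = koszul x u v w" by metis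
  have \<Gamma>_sym: "\<Gamma> u v = \<Gamma> v u" for u v
    by (rule metric_eqI[OF x]) (metis \<Gamma> koszul_sym[OF x])
  have lin: "linear (\<Gamma> u)" for u
  proof (rule linearI)
    have k: "koszul x u (a + b) w = koszul x u a w + koszul x u b w"
      "koszul x u (c *\<^sub>R a) w = c * koszul x u a w" for a b c w
      by (simp_all add: koszul_def dG_linear[OF x] field_simps)
    show "\<Gamma> u (a + b) = \<Gamma> u a + \<Gamma> u b" for a b
      by (rule metric_eqI[OF x]) (simp add: \<Gamma> k bilinear_ladd[OF bil[OF x]])
    show "\<Gamma> u (c *\<^sub>R a) = c *\<^sub>R \<Gamma> u a" for a c
      by (rule metric_eqI[OF x]) (simp add: \<Gamma> k bilinear_lmul[OF bil[OF x]])
  qed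
  have "bilinear \<Gamma>"
    unfolding bilinear_def using lin \<Gamma>_sym by (metis (no_types, lifting) ext)
  moreover have "frechet_derivative (\<lambda>y. G y u v) (at x) w = G x (\<Gamma> w u) v + G x u (\<Gamma> w v)" for u v w
    using koszul_compat[OF x, of w u v] sym[OF x, of u] by (simp add: \<Gamma> dG_def)
  ultimately have LC: "levi_civita_symbol x \<Gamma>"
    unfolding levi_civita_symbol_def using \<Gamma>_sym by blast
  have uniq: "\<Gamma>' = \<Gamma>" if "levi_civita_symbol x \<Gamma>'" for \<Gamma>'
    by (intro ext metric_eqI[OF x])
      (simp add: levi_civita_symbol_koszul[OF x that] levi_civita_symbol_koszul[OF x LC])
  have "levi_civita_symbol x (THE \<Gamma>. levi_civita_symbol x \<Gamma>)"
    using LC uniq by (rule theI)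
  then show ?thesis unfolding christoffel_def levi_civita_symbol_def[abs_def] .
qed

lemma bilinear_christoffel: "x \<in> U \<Longrightarrow> bilinear (christoffel G x)"
  and christoffel_sym: "x \<in> U \<Longrightarrow> christoffel G x u v = christoffel G x v u"
  and christoffel_compat: "x \<in> U \<Longrightarrow>
    dG x w u v = G x (christoffel G x w u) v + G x u (christoffel G x w v)"
  and christoffel_koszul: "x \<in> U \<Longrightarrow> G x (christoffel G x u v) w = koszul x u v w"
  using levi_civita_symbol_christoffel[of x] levi_civita_symbol_koszul[of x "christoffel G x"]
  unfolding levi_civita_symbol_def dG_def by blast+

definition d\<Gamma> :: "'a \<Rightarrow> 'a \<Rightarrow> 'a \<Rightarrow> 'a \<Rightarrow> 'a" where
  "d\<Gamma> x w u v = frechet_derivative (\<lambda>y. christoffel G y u v) (at x) w"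

text \<open>The symbol comes from a description, not a formula. It solves a linear equation with
  operator \<open>riesz (G y)\<close> and right side built from \<open>koszul\<close>, both
  differentiable in \<open>y\<close>, and so is differentiable itself.\<close>

lemma has_derivative_christoffel:
  assumes x: "x \<in> U"
  shows "((\<lambda>y. christoffel G y u v) has_derivative (\<lambda>w. d\<Gamma> x w u v)) (at x)"
proof -
  have "(\<lambda>y. christoffel G y u v) differentiable (at x)"
  proof (rule differentiable_linear_solution[where T = "\<lambda>y. riesz (G y)"])
    show "\<forall>\<^sub>F y in nhds x. linear (riesz (G y))"
      using eventually_in_U[OF has_derivative_ident x] by eventually_elim (intro linear_riesz bil)
    show "inj (riesz (G x))" using inj_riesz[OF bil[OF x] pos[OF x]] .
    show "(\<lambda>y. riesz (G y) a) differentiable (at x)" for a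
      unfolding riesz_def using has_derivative_G[OF x]
      by (intro differentiable_sum ballI differentiable_scaleR) (auto simp: differentiable_def)
    have "(\<lambda>y. koszul y u v j) differentiable (at x)" for j
      unfolding koszul_def using has_derivative_dG[OF x]
      by (intro differentiable_divide differentiable_add differentiable_diff) (auto simp: differentiable_def)
    then have "(\<lambda>y. \<Sum>j\<in>Basis. koszul y u v j *\<^sub>R j) differentiable (at x)"
      by (intro differentiable_sum ballI differentiable_scaleR) auto
    then obtain D where D: "((\<lambda>y. \<Sum>j\<in>Basis. koszul y u v j *\<^sub>R j) has_derivative D) (at x)"
      by (auto simp: differentiable_def)
    have "((\<lambda>y. riesz (G y) (christoffel G y u v)) has_derivative D) (at x)"
      by (rule has_derivative_transform_within_open[OF D open_U x]) (simp add: riesz_def christoffel_koszul)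
    then show "(\<lambda>y. riesz (G y) (christoffel G y u v)) differentiable (at x)"
      by (auto simp: differentiable_def)
  qed
  then show ?thesis unfolding d\<Gamma>_def by (simp add: frechet_derivative_works)
qed

text \<open>For constant fields the bracket vanishes and the first covariant derivative is just the
  Christoffel symbol.\<close>

lemma curvature_operator_const:
  assumes x: "x \<in> U"
  shows "curvature_operator G (\<lambda>_. X) (\<lambda>_. Y) (\<lambda>_. Z) x =
    d\<Gamma> x X Y Z + christoffel G x X (christoffel G x Y Z)
    - (d\<Gamma> x Y X Z + christoffel G x Y (christoffel G x X Z))"
proof -
  have c: "levi_civita G (\<lambda>_. A) (\<lambda>_. B) = (\<lambda>y. christoffel G y A B)" for A B
    by (simp add: levi_civita_def fun_eq_iff frechet_derivative_const)
  show ?thesis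
    unfolding curvature_operator_def c
    by (simp add: levi_civita_def lie_bracket_def d\<Gamma>_def frechet_derivative_const
        bilinear_lzero[OF bilinear_christoffel[OF x]])
qed

text \<open>Metric compatibility for the pullback connection: \<open>A\<close> and \<open>B\<close>
  are vector fields along the map \<open>f\<close>, and the two summands contain their covariant
  derivatives.\<close>

lemma has_derivative_metric_along:
  assumes f: "(f has_derivative f') (at x)" and fx: "f x \<in> U"
    and A: "(A has_derivative A') (at x)" and B: "(B has_derivative B') (at x)"
  shows "((\<lambda>y. G (f y) (A y) (B y)) has_derivative
    (\<lambda>w. G (f x) (A' w + christoffel G (f x) (f' w) (A x)) (B x) +
         G (f x) (A x) (B' w + christoffel G (f x) (f' w) (B x)))) (at x)"
proof -
  from eventually_in_U[OF f fx] have "\<forall>\<^sub>F y in nhds x. bilinear (G (f y))" by eventually_elim (rule bil)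
  from has_derivative_bilinear_family[OF this has_derivative_compose[OF f has_derivative_G[OF fx]] A B]
  have "((\<lambda>y. G (f y) (A y) (B y)) has_derivative (\<lambda>w. dG (f x) (f' w) (A x) (B x) +
     G (f x) (A' w) (B x) + G (f x) (A x) (B' w))) (at x)" .
  moreover have "(\<lambda>w. dG (f x) (f' w) (A x) (B x) + G (f x) (A' w) (B x) + G (f x) (A x) (B' w)) =
    (\<lambda>w. G (f x) (A' w + christoffel G (f x) (f' w) (A x)) (B x) +
         G (f x) (A x) (B' w + christoffel G (f x) (f' w) (B x)))"
    by (simp add: christoffel_compat[OF fx] bilinear_ladd[OF bil[OF fx]] bilinear_radd[OF bil[OF fx]] fun_eq_iff)
  ultimately show ?thesis by simp
qed

lemma has_derivative_christoffel_along:
  assumes f: "(f has_derivative f') (at x)" and fx: "f x \<in> U"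
    and A: "(A has_derivative A') (at x)" and B: "(B has_derivative B') (at x)"
  shows "((\<lambda>y. christoffel G (f y) (A y) (B y)) has_derivative
    (\<lambda>w. d\<Gamma> (f x) (f' w) (A x) (B x) + christoffel G (f x) (A' w) (B x) + christoffel G (f x) (A x) (B' w))) (at x)"
proof -
  from eventually_in_U[OF f fx] have "\<forall>\<^sub>F y in nhds x. bilinear (christoffel G (f y))" by eventually_elim (rule bilinear_christoffel)
  from has_derivative_bilinear_family[OF this has_derivative_compose[OF f has_derivative_christoffel[OF fx]] A B]
  show ?thesis .
qed

end

section \<open>Isometric immersions in coordinates and the Gauss equation\<close>

locale local_immersion = N: local_metric U G + M: local_metric V H
  for U :: "'n::euclidean_space set" and G and V :: "'m::euclidean_space set" and H +
  fixes F :: "'n \<Rightarrow> 'm"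
  assumes smooth_F: "smooth_on U F" and F_into: "\<And>x. x \<in> U \<Longrightarrow> F x \<in> V"
    and isometric: "\<And>x u v. x \<in> U \<Longrightarrow>
      G x u v = H (F x) (frechet_derivative F (at x) u) (frechet_derivative F (at x) v)"
begin

text \<open>The point is the last argument, so that \<open>F1 v\<close> is a function on
  \<open>U\<close> that can be differentiated again; in \<open>F2\<close> and \<open>F3\<close> the
  newest direction comes first.\<close>

definition F1 :: "'n \<Rightarrow> 'n \<Rightarrow> 'm" where
  "F1 u x = frechet_derivative F (at x) u"

definition F2 :: "'n \<Rightarrow> 'n \<Rightarrow> 'n \<Rightarrow> 'm" where
  "F2 u v x = frechet_derivative (F1 v) (at x) u"

definition F3 :: "'n \<Rightarrow> 'n \<Rightarrow> 'n \<Rightarrow> 'n \<Rightarrow> 'm" where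
  "F3 u v w x = frechet_derivative (F2 v w) (at x) u"

lemma smooth_F1: "smooth_on U (F1 v)"
  unfolding F1_def using smooth_on_frechet_derivative[OF smooth_F] .

lemma has_derivative_F: "x \<in> U \<Longrightarrow> (F has_derivative (\<lambda>w. F1 w x)) (at x)"
  unfolding F1_def using smooth_on_has_derivative[OF smooth_F] .

lemma has_derivative_F1: "x \<in> U \<Longrightarrow> (F1 v has_derivative (\<lambda>w. F2 w v x)) (at x)"
  unfolding F2_def using smooth_on_has_derivative[OF smooth_F1] .

lemma has_derivative_F2: "x \<in> U \<Longrightarrow> (F2 u v has_derivative (\<lambda>w. F3 w u v x)) (at x)"
  unfolding F3_def
  using smooth_on_has_derivative[OF smooth_on_frechet_derivative[OF smooth_F1[of v], of u]]
  by (simp add: F2_def[abs_def])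

lemma linear_F1: "x \<in> U \<Longrightarrow> linear (\<lambda>u. F1 u x)"
  using has_derivative_linear[OF has_derivative_F] .

lemma F2_sym: "x \<in> U \<Longrightarrow> F2 u v x = F2 v u x"
  using smooth_on_frechet_derivative_commute[OF smooth_F N.open_U]
  by (simp add: F2_def F1_def[abs_def])

lemma F3_sym: "x \<in> U \<Longrightarrow> F3 u v w x = F3 v u w x"
  using smooth_on_frechet_derivative_commute[OF smooth_F1 N.open_U]
  by (simp add: F3_def F2_def[abs_def])

lemma bilinear_F2: "x \<in> U \<Longrightarrow> bilinear (\<lambda>u v. F2 u v x)"
  unfolding bilinear_def
  using has_derivative_linear[OF has_derivative_F1] F2_sym by simp

lemma isometric_F1: "x \<in> U \<Longrightarrow> G x u v = H (F x) (F1 u x) (F1 v x)"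
  unfolding F1_def by (rule isometric)

text \<open>\<open>S u v\<close> is the ambient covariant derivative along \<open>u\<close> of the image of the
  constant field \<open>v\<close>, and \<open>DS w u v\<close> below is the one of \<open>S u v\<close> along \<open>w\<close>.\<close>

definition S :: "'n \<Rightarrow> 'n \<Rightarrow> 'n \<Rightarrow> 'm" where
  "S u v x = F2 u v x + christoffel H (F x) (F1 u x) (F1 v x)"

definition second_fundamental_form :: "'n \<Rightarrow> 'n \<Rightarrow> 'n \<Rightarrow> 'm" where
  "second_fundamental_form x u v = S u v x - F1 (christoffel G x u v) x"

lemma S_sym: "x \<in> U \<Longrightarrow> S u v x = S v u x"
  by (simp add: S_def F2_sym M.christoffel_sym[OF F_into])

lemma linear_S:
  assumes x: "x \<in> U"
  shows "linear (\<lambda>v. S u v x)"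
proof -
  note b = bilinear_F2[OF x] M.bilinear_christoffel[OF F_into[OF x]]
  show ?thesis
    using bilinear_radd[OF b(1)] bilinear_rmul[OF b(1)]
    by (intro linearI)
      (simp_all add: S_def bilinear_radd[OF b(2)] bilinear_rmul[OF b(2)] linear_add[OF linear_F1[OF x]]
        linear_scale[OF linear_F1[OF x]] scaleR_add_right)
qed

text \<open>Differentiating the isometry identity shows that the left side has the symmetry and
  compatibility that characterise the Koszul form. So the tangential part of \<open>S\<close> is the
  image of the intrinsic covariant derivative.\<close>

lemma S_tangential:
  assumes x: "x \<in> U"
  shows "H (F x) (S u v x) (F1 w x) = G x (christoffel G x u v) w"
proof -
  have "N.koszul x u v w = H (F x) (S u v x) (F1 w x)"
  proof (rule N.koszul_unique[OF x])
    show "H (F x) (S u v x) (F1 w x) = H (F x) (S v u x) (F1 w x)" for u v w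
      by (simp add: S_sym[OF x])
    show "N.dG x w u v = H (F x) (S w u x) (F1 v x) + H (F x) (S w v x) (F1 u x)" for u v w
      using N.dG_unique[OF x M.has_derivative_metric_along[OF has_derivative_F[OF x] F_into[OF x]
            has_derivative_F1[OF x] has_derivative_F1[OF x]], of u v u v w]
      by (simp add: isometric_F1 S_def M.sym[OF F_into[OF x], of "F1 u x"])
  qed
  then show ?thesis by (simp add: N.christoffel_koszul[OF x])
qed

lemma second_fundamental_form_sym:
  "x \<in> U \<Longrightarrow> second_fundamental_form x u v = second_fundamental_form x v u"
  by (simp add: second_fundamental_form_def S_sym N.christoffel_sym)

lemma bilinear_second_fundamental_form:
  assumes x: "x \<in> U"
  shows "bilinear (second_fundamental_form x)"
proof -
  have "linear (second_fundamental_form x u)" for u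
    using linear_add[OF linear_S[OF x, of u]] linear_scale[OF linear_S[OF x, of u]]
    by (intro linearI)
      (simp_all add: second_fundamental_form_def bilinear_radd[OF N.bilinear_christoffel[OF x]]
        bilinear_rmul[OF N.bilinear_christoffel[OF x]] linear_add[OF linear_F1[OF x]]
        linear_scale[OF linear_F1[OF x]] scaleR_diff_right)
  moreover have "(\<lambda>u. second_fundamental_form x u v) = second_fundamental_form x v" for v
    by (intro ext second_fundamental_form_sym x)
  ultimately show ?thesis by (simp add: bilinear_def)
qed

lemma second_fundamental_form_normal:
  "x \<in> U \<Longrightarrow> H (F x) (second_fundamental_form x u v) (F1 w x) = 0"
  by (simp add: second_fundamental_form_def bilinear_lsub[OF M.bil[OF F_into]] S_tangential isometric_F1)

text \<open>\<open>S\<close> splits into the normal part \<open>second_fundamental_form\<close> and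
  a tangential part; the mixed products vanish and the tangential one is computed by the
  isometry.\<close>

lemma inner_S:
  assumes x: "x \<in> U"
  shows "H (F x) (S a b x) (S c d x) =
    H (F x) (second_fundamental_form x a b) (second_fundamental_form x c d) +
    G x (christoffel G x a b) (christoffel G x c d)"
proof -
  note b = M.bil[OF F_into[OF x]]
  have S: "S u v x = second_fundamental_form x u v + F1 (christoffel G x u v) x" for u v
    by (simp add: second_fundamental_form_def)
  show ?thesis
    unfolding S bilinear_ladd[OF b] bilinear_radd[OF b]
    by (simp add: second_fundamental_form_normal[OF x] isometric_F1[OF x]
        M.sym[OF F_into[OF x], of "F1 _ x" "second_fundamental_form _ _ _"])
qed

lemma has_derivative_S:
  assumes x: "x \<in> U"
  shows "(S u v has_derivative (\<lambda>w. F3 w u v x + (M.d\<Gamma> (F x) (F1 w x) (F1 u x) (F1 v x)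
     + christoffel H (F x) (F2 w u x) (F1 v x) + christoffel H (F x) (F1 u x) (F2 w v x)))) (at x)"
  unfolding S_def[abs_def]
  by (intro has_derivative_add has_derivative_F2 M.has_derivative_christoffel_along has_derivative_F
      has_derivative_F1 F_into x)

definition DS :: "'n \<Rightarrow> 'n \<Rightarrow> 'n \<Rightarrow> 'n \<Rightarrow> 'm" where
  "DS w u v x = F3 w u v x + (M.d\<Gamma> (F x) (F1 w x) (F1 u x) (F1 v x)
     + christoffel H (F x) (F2 w u x) (F1 v x) + christoffel H (F x) (F1 u x) (F2 w v x))
     + christoffel H (F x) (F1 w x) (S u v x)"

text \<open>Exchanging \<open>X\<close> and \<open>Y\<close> cancels the terms with second and third
  derivatives of \<open>F\<close>; what remains is the ambient curvature on constant fields.\<close>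

lemma ambient_curvature:
  assumes x: "x \<in> U"
  shows "curvature_operator H (\<lambda>_. F1 X x) (\<lambda>_. F1 Y x) (\<lambda>_. F1 Z x) (F x) = DS X Y Z x - DS Y X Z x"
  unfolding M.curvature_operator_const[OF F_into[OF x]] DS_def
  using F2_sym[OF x, of X Y] F3_sym[OF x, of X Y Z]
  by (simp add: S_def bilinear_radd[OF M.bilinear_christoffel[OF F_into[OF x]]])

text \<open>\<open>S_tangential\<close> holds on all of the open set \<open>U\<close>, so both sides
  have the same derivative along \<open>X\<close>; each is computed with
  \<open>has_derivative_metric_along\<close>.\<close>

lemma second_derivative_tangential:
  assumes x: "x \<in> U"
  shows "H (F x) (DS X Y Z x) (F1 W x) + H (F x) (S Y Z x) (S X W x) =
    G x (N.d\<Gamma> x X Y Z + christoffel G x X (christoffel G x Y Z)) W +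
    G x (christoffel G x Y Z) (christoffel G x X W)"
proof -
  note M' = M.has_derivative_metric_along[OF has_derivative_F[OF x] F_into[OF x]
      has_derivative_S[OF x, of Y Z] has_derivative_F1[OF x, of W]]
  note N' = N.has_derivative_metric_along[where f = "\<lambda>y. y", OF has_derivative_ident x
      N.has_derivative_christoffel[OF x, of Y Z] has_derivative_const[of W]]
  note eq = has_derivative_unique[OF N' has_derivative_transform_within_open[OF M' N.open_U x S_tangential]]
  show ?thesis
    using fun_cong[OF eq, of X] by (simp add: DS_def S_def)
qed

text \<open>Antisymmetrise \<open>second_derivative_tangential\<close> in \<open>X\<close> and
  \<open>Y\<close>. By \<open>inner_S\<close> the products of Christoffel symbols cancel, leaving
  the two curvatures and the products of \<open>\<beta>\<close>.\<close>

theorem gauss_equation: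
  assumes x: "x \<in> U"
  defines "\<beta> \<equiv> second_fundamental_form x"
  shows "H (F x) (curvature_operator H (\<lambda>_. F1 X x) (\<lambda>_. F1 Y x) (\<lambda>_. F1 Z x) (F x)) (F1 W x) =
    G x (curvature_operator G (\<lambda>_. X) (\<lambda>_. Y) (\<lambda>_. Z) x) W
    - H (F x) (\<beta> Y Z) (\<beta> X W) + H (F x) (\<beta> X Z) (\<beta> Y W)"
  using second_derivative_tangential[OF x, of X Y Z W] second_derivative_tangential[OF x, of Y X Z W]
  unfolding ambient_curvature[OF x] N.curvature_operator_const[OF x] \<beta>_def
    bilinear_lsub[OF M.bil[OF F_into[OF x]]] bilinear_lsub[OF N.bil[OF x]] inner_S[OF x]
  by simp

end

subsection \<open>Quadratic maps between inner product spaces\<close>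

lemma exists_orthonormal:
  fixes g :: "'a::euclidean_space \<Rightarrow> 'a \<Rightarrow> real"
  assumes g: "bilinear g" and sym: "\<And>u v. g u v = g v u" and pos: "\<And>u. u \<noteq> 0 \<Longrightarrow> g u u > 0"
    and S: "subspace S" and "k \<le> dim S"
  shows "\<exists>e::nat \<Rightarrow> 'a. \<forall>i\<in>{1..k}. e i \<in> S \<and> (\<forall>j\<in>{1..k}. g (e i) (e j) = (if i = j then 1 else 0))"
  using \<open>k \<le> dim S\<close>
proof (induction k)
  case (Suc k)
  then obtain e where e: "\<And>i. i \<in> {1..k} \<Longrightarrow> e i \<in> S"
    "\<And>i j. i \<in> {1..k} \<Longrightarrow> j \<in> {1..k} \<Longrightarrow> g (e i) (e j) = (if i = j then 1 else 0)"
    by fastforce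
  \<comment> \<open>Gram-Schmidt: the span of \<open>k\<close> vectors cannot contain
    \<open>S\<close>, so some \<open>v\<close> in \<open>S\<close> lies outside it; subtracting its
    projection and normalising gives the next vector.\<close>
  have "dim (e ` {1..k}) \<le> card (e ` {1..k})" by (rule dim_le_card') simp
  also have "\<dots> \<le> k" using card_image_le[of "{1..k}" e] by simp
  finally have "dim (span (e ` {1..k})) < dim S" using Suc.prems by simp
  then have "\<not> S \<subseteq> span (e ` {1..k})" by (metis dim_subset linorder_not_less)
  then obtain v where v: "v \<in> S" "v \<notin> span (e ` {1..k})" by blast
  define w where "w = v - (\<Sum>i\<in>{1..k}. g v (e i) *\<^sub>R e i)"
  have wS: "w \<in> S"
    unfolding w_def using v e S by (intro subspace_diff subspace_sum subspace_scale) auto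
  have "w \<noteq> 0"
  proof
    assume "w = 0"
    then have "v = (\<Sum>i\<in>{1..k}. g v (e i) *\<^sub>R e i)" by (simp add: w_def)
    also have "\<dots> \<in> span (e ` {1..k})" by (intro span_sum span_scale span_base) auto
    finally show False using v by blast
  qed
  then have gw: "g w w > 0" by (rule pos)
  have orth: "g w (e j) = 0" if j: "j \<in> {1..k}" for j
  proof -
    have l: "linear (\<lambda>x. g x (e j))" using g by (simp add: bilinear_def)
    have "g w (e j) = g v (e j) - (\<Sum>i\<in>{1..k}. g v (e i) * g (e i) (e j))"
      unfolding w_def by (simp add: bilinear_lsub[OF g] linear_sum[OF l] linear_scale[OF l])
    also have "(\<Sum>i\<in>{1..k}. g v (e i) * g (e i) (e j)) = (\<Sum>i\<in>{1..k}. if i = j then g v (e j) else 0)"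
      using e(2) j by (intro sum.cong) auto
    finally show ?thesis using j by simp
  qed
  define e' where "e' = e(Suc k := (1 / sqrt (g w w)) *\<^sub>R w)"
  have old: "e' i = e i" if "i \<in> {1..k}" for i using that by (simp add: e'_def)
  have new: "e' (Suc k) = (1 / sqrt (g w w)) *\<^sub>R w" by (simp add: e'_def)
  have unit: "g (e' (Suc k)) (e' (Suc k)) = 1"
    using gw by (simp add: new bilinear_lmul[OF g] bilinear_rmul[OF g])
  have orth': "g (e' (Suc k)) (e' j) = 0" "g (e' j) (e' (Suc k)) = 0" if "j \<in> {1..k}" for j
    using orth[OF that] by (simp_all add: new old[OF that] bilinear_lmul[OF g] bilinear_rmul[OF g] sym[of "e j" w])
  have inS: "e' (Suc k) \<in> S" using wS S by (simp add: new subspace_scale)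
  have split: "i = Suc k \<or> i \<in> {1..k}" if "i \<in> {1..Suc k}" for i using that by auto
  have "e' i \<in> S \<and> (\<forall>j\<in>{1..Suc k}. g (e' i) (e' j) = (if i = j then 1 else 0))"
    if "i \<in> {1..Suc k}" for i
    using split[OF that]
  proof
    assume i: "i = Suc k"
    show ?thesis using i inS unit orth' split by fastforce
  next
    assume i: "i \<in> {1..k}"
    have "g (e' i) (e' j) = (if i = j then 1 else 0)" if "j \<in> {1..Suc k}" for j
      using split[OF that] i orth' e(2) old by fastforce
    then show ?thesis using i e(1) old by simp
  qed
  then show ?case by blast
qed simp

text \<open>\<open>f\<close> is injective on the Euclidean orthogonal complement of its
  kernel.\<close>

lemma dim_kernel_range:
  fixes f :: "'a::euclidean_space \<Rightarrow> 'b::euclidean_space"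
  assumes f: "linear f"
  shows "DIM('a) \<le> dim {x. f x = 0} + dim (range f)"
proof -
  define K where "K = {x. f x = 0}"
  define P where "P = {y. \<forall>x\<in>K. orthogonal x y}"
  have K: "subspace K" unfolding K_def by (rule linear_subspace_kernel[OF f])
  have P: "subspace P" unfolding P_def by (rule subspace_orthogonal_to_vectors)
  have "dim P + dim K = DIM('a)"
    using dim_subspace_orthogonal_to_vectors[OF K subspace_UNIV] by (simp add: P_def)
  moreover have "inj_on f (span P)"
  proof (rule inj_onI)
    fix x y assume "x \<in> span P" "y \<in> span P" "f x = f y"
    then have "x - y \<in> P" "x - y \<in> K"
      using P by (auto simp: K_def linear_diff[OF f] subspace_diff span_eq_iff[THEN iffD2])
    then show "x = y" by (auto simp: P_def orthogonal_self)
  qed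
  then have "dim (f ` P) = dim P" by (rule dim_image_eq[OF f])
  moreover have "dim (f ` P) \<le> dim (range f)" by (intro dim_subset) auto
  ultimately show ?thesis unfolding K_def by simp
qed

text \<open>The space is the normal space of the immersion. By positivity it meets the tangent space
  \<open>range L\<close> only in 0, which bounds it by the codimension.\<close>

lemma dim_normal_space:
  fixes h :: "'m::euclidean_space \<Rightarrow> 'm \<Rightarrow> real" and L :: "'n::euclidean_space \<Rightarrow> 'm"
  assumes h: "bilinear h" and pos: "\<And>u. u \<noteq> 0 \<Longrightarrow> h u u > 0" and L: "linear L" "inj L"
  shows "subspace {w. \<forall>v. h w (L v) = 0}" "dim {w. \<forall>v. h w (L v) = 0} + DIM('n) \<le> DIM('m)"
proof -
  show W: "subspace {w. \<forall>v. h w (L v) = 0}" (is "subspace ?W")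
    by (auto simp: subspace_def bilinear_lzero[OF h] bilinear_ladd[OF h] bilinear_lmul[OF h])
  have R: "subspace (range L)" using L(1) subspace_UNIV by (rule linear_subspace_image)
  have "?W \<inter> range L = {0}"
  proof
    show "?W \<inter> range L \<subseteq> {0}" using pos by fastforce
    show "{0} \<subseteq> ?W \<inter> range L" using subspace_0[OF W] subspace_0[OF R] by blast
  qed
  moreover have "dim (range L) = DIM('n)"
    using dim_image_eq[OF L(1), of UNIV] L(2) by simp
  ultimately show "dim ?W + DIM('n) \<le> DIM('m)"
    using dim_sums_Int[OF W R] dim_subset_UNIV[of "{x + y |x y. x \<in> ?W \<and> y \<in> range L}"] by simp
qed

section \<open>Minimisation on the unit sphere and Otsuki's argument\<close>

lemma exists_min_on_unit_sphere:
  fixes g :: "'a::euclidean_space \<Rightarrow> 'a \<Rightarrow> real" and \<phi> :: "'a \<Rightarrow> real"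
  assumes g: "bilinear g" and pos: "\<And>u. u \<noteq> 0 \<Longrightarrow> g u u > 0" and \<phi>: "continuous_on UNIV \<phi>"
  obtains u where "g u u = 1" "\<And>v. g v v = 1 \<Longrightarrow> \<phi> u \<le> \<phi> v"
proof -
  have bb: "bounded_bilinear g" using g by (simp add: bilinear_conv_bounded_bilinear)
  have cont: "continuous_on UNIV (\<lambda>u. g u u)"
    by (intro bounded_bilinear.continuous_on[OF bb] continuous_on_id)
  \<comment> \<open>The minimum of \<open>g\<close> on the Euclidean sphere serves as a coercivity
    constant, which makes the \<open>g\<close>-unit sphere bounded and hence compact.\<close>
  obtain b where b: "b \<in> sphere (0::'a) 1" "\<And>y. y \<in> sphere 0 1 \<Longrightarrow> g b b \<le> g y y"
    using continuous_attains_inf[OF compact_sphere, of "0::'a" 1 "\<lambda>u. g u u"] continuous_on_subset[OF cont]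
    by (auto simp: SOME_Basis)
  have gb: "g b b > 0" using b(1) by (intro pos) auto
  have hom: "g (c *\<^sub>R v) (c *\<^sub>R v) = c\<^sup>2 * g v v" for c v
    by (simp add: bilinear_lmul[OF g] bilinear_rmul[OF g] power2_eq_square)
  have coercive: "g b b * (norm v)\<^sup>2 \<le> g v v" for v
  proof (cases "v = 0")
    case False
    then have "g b b \<le> g ((1 / norm v) *\<^sub>R v) ((1 / norm v) *\<^sub>R v)" by (intro b(2)) simp
    then show ?thesis using False by (simp add: hom power_divide field_simps)
  qed (simp add: bilinear_lzero[OF g])
  have "bounded {u. g u u = 1}"
  proof (rule boundedI)
    fix v assume "v \<in> {u. g u u = 1}"
    then have "(norm v)\<^sup>2 \<le> 1 / g b b" using coercive[of v] gb by (simp add: field_simps)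
    then show "norm v \<le> sqrt (1 / g b b)" by (rule real_le_rsqrt)
  qed
  moreover have "closed {u. g u u = 1}"
    using cont by (intro closed_Collect_eq) auto
  ultimately have comp: "compact {u. g u u = 1}" by (simp add: compact_eq_bounded_closed)
  have "g ((1 / sqrt (g b b)) *\<^sub>R b) ((1 / sqrt (g b b)) *\<^sub>R b) = 1"
    using gb by (simp add: hom power_divide)
  then have "{u. g u u = 1} \<noteq> {}" by blast
  from continuous_attains_inf[OF comp this continuous_on_subset[OF \<phi>]] show ?thesis
    using that by auto
qed

text \<open>Otsuki's argument: \<open>u\<close> minimises \<open>h (\<beta> u u) (\<beta> u u)\<close> on the \<open>g\<close>-unit sphere, and the \<open>e i\<close>
  lie in the kernel of \<open>\<beta> u\<close>, for which the second variation gives the inequality.\<close>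

lemma otsuki:
  fixes g :: "'n::euclidean_space \<Rightarrow> 'n \<Rightarrow> real" and h :: "'m::euclidean_space \<Rightarrow> 'm \<Rightarrow> real"
    and L :: "'n \<Rightarrow> 'm" and \<beta> :: "'n \<Rightarrow> 'n \<Rightarrow> 'm"
  assumes g: "bilinear g" and g_sym: "\<And>u v. g u v = g v u" and g_pos: "\<And>u. u \<noteq> 0 \<Longrightarrow> g u u > 0"
    and h: "bilinear h" and h_sym: "\<And>u v. h u v = h v u" and h_pos: "\<And>u. u \<noteq> 0 \<Longrightarrow> h u u > 0"
    and L: "linear L" "inj L"
    and \<beta>: "bilinear \<beta>" and \<beta>_sym: "\<And>u v. \<beta> u v = \<beta> v u"
    and normal: "\<And>u v w. h (\<beta> u v) (L w) = 0"
    and dim: "DIM('m) + k < 2 * DIM('n)"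
  obtains u e where "g u u = 1" "\<And>i. i \<in> {1..k} \<Longrightarrow> g u (e i) = 0"
    "\<And>i j. i \<in> {1..k} \<Longrightarrow> j \<in> {1..k} \<Longrightarrow> g (e i) (e j) = (if i = j then 1 else 0)"
    "\<And>i. i \<in> {1..k} \<Longrightarrow> \<beta> u (e i) = 0"
    "\<And>i. i \<in> {1..k::nat} \<Longrightarrow> h (\<beta> u u) (\<beta> (e i) (e i)) \<ge> 0"
proof -
  define q where "q v = h (\<beta> v v) (\<beta> v v)" for v
  have bb: "bounded_bilinear h" "bounded_bilinear \<beta>" using h \<beta> by (simp_all add: bilinear_conv_bounded_bilinear)
  have "continuous_on UNIV q" unfolding q_def
    by (intro bounded_bilinear.continuous_on[OF bb(1)] bounded_bilinear.continuous_on[OF bb(2)] continuous_on_id)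
  then obtain u where u: "g u u = 1" "\<And>v. g v v = 1 \<Longrightarrow> q u \<le> q v"
    using exists_min_on_unit_sphere[OF g g_pos] by blast
  define W where "W = {w. \<forall>v. h w (L v) = 0}"
  have W: "subspace W" "dim W + DIM('n) \<le> DIM('m)"
    using dim_normal_space[OF h h_pos L] by (simp_all add: W_def)
  \<comment> \<open>The kernel of \<open>\<Phi>\<close> encodes both conditions on the
    \<open>e i\<close>. Its values lie in \<open>W \<times> UNIV\<close>, so it has dimension at
    least \<open>2 * DIM('n) - DIM('m) - 1\<close>, and the strict inequality in \<open>dim\<close>
    makes this at least \<open>k\<close>.\<close>
  define \<Phi> where "\<Phi> v = (\<beta> u v, g u v)" for v
  have \<Phi>: "linear \<Phi>"
    unfolding \<Phi>_def by (intro linearI) (simp_all add: bilinear_radd[OF g] bilinear_radd[OF \<beta>] bilinear_rmul[OF g] bilinear_rmul[OF \<beta>])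
  have "range \<Phi> \<subseteq> W \<times> UNIV" using normal by (auto simp: \<Phi>_def W_def)
  then have "dim (range \<Phi>) \<le> dim (W \<times> (UNIV :: real set))" by (rule dim_subset)
  also have "\<dots> = dim W + 1" using W(1) by (simp add: dim_Times)
  finally have "k \<le> dim {v. \<Phi> v = 0}"
    using dim_kernel_range[OF \<Phi>] W(2) dim by linarith
  then obtain e where e: "\<And>i. i \<in> {1..k} \<Longrightarrow> \<Phi> (e i) = 0"
    "\<And>i j. i \<in> {1..k} \<Longrightarrow> j \<in> {1..k} \<Longrightarrow> g (e i) (e j) = (if i = j then 1 else 0)"
    using exists_orthonormal[OF g g_sym g_pos linear_subspace_kernel[OF \<Phi>]] by blast
  have ker: "\<beta> u (e i) = 0" "g u (e i) = 0" if "i \<in> {1..k}" for i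
    using e(1)[OF that] by (simp_all add: \<Phi>_def zero_prod_def)
  have q_hom: "q (c *\<^sub>R v) = c ^ 4 * q v" for c v
    by (simp add: q_def bilinear_lmul[OF \<beta>] bilinear_rmul[OF \<beta>] bilinear_lmul[OF h] bilinear_rmul[OF h] power4_eq_xxxx)
  \<comment> \<open>\<open>q\<close> has degree 4 and \<open>g v v\<close> degree 2, so rescaling
    extends minimality from the unit sphere to all nonzero vectors.\<close>
  have min: "q u * (g v v)\<^sup>2 \<le> q v" if "v \<noteq> 0" for v
  proof -
    have gv: "g v v > 0" using that by (rule g_pos)
    have "g ((1 / sqrt (g v v)) *\<^sub>R v) ((1 / sqrt (g v v)) *\<^sub>R v) = 1"
      using gv by (simp add: bilinear_lmul[OF g] bilinear_rmul[OF g])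
    then have "q u \<le> (1 / sqrt (g v v)) ^ 4 * q v" using u(2) q_hom by metis
    also have "(1 / sqrt (g v v)) ^ 4 = 1 / (g v v)\<^sup>2"
      using gv by (simp add: power_divide power4_eq_xxxx power2_eq_square)
    finally show ?thesis using gv by (simp add: field_simps)
  qed
  have "h (\<beta> u u) (\<beta> (e i) (e i)) \<ge> 0" if i: "i \<in> {1..k}" for i
  proof (rule ccontr)
    define a b c where "a = q u" and "b = h (\<beta> u u) (\<beta> (e i) (e i))" and "c = q (e i)"
    assume "\<not> h (\<beta> u u) (\<beta> (e i) (e i)) \<ge> 0"
    then have b: "b < 0" by (simp add: b_def)
    have nonneg: "q v \<ge> 0" for v
      using h_pos[of "\<beta> v v"] by (cases "\<beta> v v = 0") (auto simp: q_def bilinear_lzero[OF h])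
    have *: "0 \<le> 2 * b + s * c" if "s > 0" for s
    proof -
      \<comment> \<open>Because \<open>e i\<close> is orthogonal to \<open>u\<close> and killed by
        \<open>\<beta> u\<close>, the odd powers of \<open>sqrt s\<close> drop out of
        \<open>g v v\<close> and \<open>q v\<close>, which become polynomials in
        \<open>s\<close>.\<close>
      define v where "v = u + sqrt s *\<^sub>R e i"
      have gv: "g v v = 1 + s"
        using that u(1) ker(2)[OF i] e(2)[OF i i] g_sym[of "e i" u]
        by (simp add: v_def bilinear_ladd[OF g] bilinear_radd[OF g] bilinear_lmul[OF g] bilinear_rmul[OF g])
      then have "v \<noteq> 0" using that by (auto simp: bilinear_lzero[OF g])
      have "\<beta> v v = \<beta> u u + s *\<^sub>R \<beta> (e i) (e i)"
        using that ker(1)[OF i] \<beta>_sym[of "e i" u]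
        by (simp add: v_def bilinear_ladd[OF \<beta>] bilinear_radd[OF \<beta>] bilinear_lmul[OF \<beta>] bilinear_rmul[OF \<beta>])
      then have "q v = a + 2 * s * b + s * s * c"
        using h_sym[of "\<beta> (e i) (e i)" "\<beta> u u"]
        by (simp add: q_def a_def b_def c_def bilinear_ladd[OF h] bilinear_radd[OF h] bilinear_lmul[OF h] bilinear_rmul[OF h] algebra_simps)
      then have "a * (1 + s)\<^sup>2 \<le> a + 2 * s * b + s * s * c"
        using min[OF \<open>v \<noteq> 0\<close>] gv by (simp add: a_def)
      moreover have "a * 1 \<le> a * (1 + s)\<^sup>2"
        using nonneg[of u] that by (intro mult_left_mono) (auto simp: a_def)
      ultimately have "0 \<le> s * (2 * b + s * c)" by (simp add: algebra_simps)
      then show ?thesis using that by (simp add: zero_le_mult_iff)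
    qed
    have "c \<ge> 0" using nonneg by (simp add: c_def)
    \<comment> \<open>This \<open>s\<close> is positive as \<open>b < 0\<close>, and small enough
      that \<open>s * c \<le> - b\<close>; the added 1 covers \<open>c = 0\<close>.\<close>
    have "0 \<le> 2 * b + (- b / (c + 1)) * c" using b \<open>c \<ge> 0\<close> by (intro *) (simp add: divide_neg_pos)
    also have "\<dots> \<le> 2 * b - b"
    proof -
      have "c / (c + 1) \<le> 1" using \<open>c \<ge> 0\<close> by simp
      then have "- b * (c / (c + 1)) \<le> - b * 1" using b by (intro mult_left_mono) auto
      then show ?thesis by simp
    qed
    finally show False using b by simp
  qed
  with u(1) ker e(2) show ?thesis using that by blast
qed

subsection \<open>Charts\<close>

lemma Ck_on_subset: "Ck_on k S f \<Longrightarrow> T \<subseteq> S \<Longrightarrow> Ck_on k T f"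
  by (induction k arbitrary: f) (auto intro: continuous_on_subset)

lemma smooth_on_subset: "smooth_on S f \<Longrightarrow> T \<subseteq> S \<Longrightarrow> smooth_on T f"
  unfolding smooth_on_def using Ck_on_subset by blast

locale charted =
  fixes N :: "('p, 'a::euclidean_space) riemannian"
  assumes manifold: "smooth_manifold (top_of N) (atlas N)"
begin

lemma chart_subset_topspace: "c \<in> atlas N \<Longrightarrow> fst c \<subseteq> topspace (top_of N)"
  using manifold unfolding smooth_manifold_def by blast

lemma chart_inj: "c \<in> atlas N \<Longrightarrow> inj_on (snd c) (fst c)"
  using homeomorphic_imp_injective_map[of "subtopology (top_of N) (fst c)"] chart_subset_topspace[of c] manifold
  unfolding smooth_manifold_def by (metis inf.absorb2 topspace_subtopology)

lemma chart_inv_chart [simp]: "c \<in> atlas N \<Longrightarrow> q \<in> fst c \<Longrightarrow> chart_inv c (snd c q) = q"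
  unfolding chart_inv_def using chart_inj by (rule inv_into_f_f)

lemma open_chart_image:
  assumes c: "c \<in> atlas N" and Q: "openin (top_of N) Q"
  shows "open (snd c ` (fst c \<inter> Q))"
proof -
  have hom: "homeomorphic_map (subtopology (top_of N) (fst c)) (top_of_set (snd c ` fst c)) (snd c)"
    and o: "open (snd c ` fst c)"
    using manifold c unfolding smooth_manifold_def by blast+
  have "openin (subtopology (top_of N) (fst c)) (fst c \<inter> Q)"
    using Q by (metis inf_commute openin_subtopology_Int)
  then have "openin (top_of_set (snd c ` fst c)) (snd c ` (fst c \<inter> Q))"
    using homeomorphic_imp_open_map[OF hom] unfolding open_map_def by blast
  then show ?thesis using o openin_open_trans by blast
qed

lemma openin_chart: "c \<in> atlas N \<Longrightarrow> openin (top_of N) (fst c)"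
  using manifold unfolding smooth_manifold_def by blast

lemma charts_atD: "c \<in> charts_at N q \<Longrightarrow> c \<in> atlas N" "c \<in> charts_at N q \<Longrightarrow> q \<in> fst c"
  by (simp_all add: charts_at_def)

lemma chart_at_in: "q \<in> topspace (top_of N) \<Longrightarrow> chart_at N q \<in> charts_at N q"
  using manifold unfolding smooth_manifold_def chart_at_def charts_at_def
  by (intro someI_ex[of "\<lambda>c. c \<in> {c \<in> atlas N. q \<in> fst c}"]) blast

lemma chart_at_in': "c \<in> charts_at N q \<Longrightarrow> chart_at N q \<in> charts_at N q"
  unfolding chart_at_def by (rule someI)

lemma has_derivative_transition:
  assumes "c \<in> charts_at N q" "d \<in> charts_at N q"
  shows "((snd d \<circ> chart_inv c) has_derivative coord_change c d q) (at (snd c q))"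
  unfolding coord_change_def
proof (rule smooth_on_has_derivative)
  show "smooth_on (snd c ` (fst c \<inter> fst d)) (snd d \<circ> chart_inv c)"
    using manifold charts_atD(1)[OF assms(1)] charts_atD(1)[OF assms(2)]
    unfolding smooth_manifold_def by blast
  show "snd c q \<in> snd c ` (fst c \<inter> fst d)" using assms by (auto dest: charts_atD)
qed

text \<open>The chain rule through the transition map; the charts cancel on the overlap, whose image
  is open. Taking \<open>\<psi>\<close> to be a chart gives the cocycle rule for
  \<open>coord_change\<close>; composing it with \<open>f\<close> compares the differential in two
  charts.\<close>

lemma has_derivative_chart_change:
  fixes \<psi> :: "'p \<Rightarrow> 'b::real_normed_vector"
  assumes c: "c \<in> charts_at N q" and d: "d \<in> charts_at N q"
    and \<psi>: "((\<psi> \<circ> chart_inv d) has_derivative \<psi>') (at (snd d q))"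
  shows "((\<psi> \<circ> chart_inv c) has_derivative (\<lambda>u. \<psi>' (coord_change c d q u))) (at (snd c q))"
proof -
  note cd = charts_atD[OF c] charts_atD[OF d]
  have "((\<psi> \<circ> chart_inv d) has_derivative \<psi>') (at ((snd d \<circ> chart_inv c) (snd c q)))"
    using \<psi> cd by simp
  from has_derivative_compose[OF has_derivative_transition[OF c d] this]
  show ?thesis
    by (rule has_derivative_transform_within_open[OF _ open_chart_image[OF cd(1) openin_chart[OF cd(3)]]])
      (use cd in auto)
qed

lemma coord_change_compose:
  assumes "c \<in> charts_at N q" "d \<in> charts_at N q" "e \<in> charts_at N q"
  shows "coord_change c e q u = coord_change d e q (coord_change c d q u)"
  using fun_cong[OF has_derivative_unique[OF has_derivative_transition[OF assms(1,3)]
        has_derivative_chart_change[OF assms(1,2) has_derivative_transition[OF assms(2,3)]]], of u] .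

lemma coord_change_self:
  assumes c: "c \<in> charts_at N q"
  shows "coord_change c c q u = u"
proof -
  note c' = charts_atD[OF c]
  have "((\<lambda>x. x) has_derivative (\<lambda>x. x)) (at (snd c q))" by (rule has_derivative_ident)
  then have "((snd c \<circ> chart_inv c) has_derivative (\<lambda>x. x)) (at (snd c q))"
    by (rule has_derivative_transform_within_open[OF _ open_chart_image[OF c'(1) openin_chart[OF c'(1)]]])
      (use c' in auto)
  from fun_cong[OF has_derivative_unique[OF has_derivative_transition[OF c c] this], of u] show ?thesis .
qed

lemma coord_vector_apply: "c \<in> charts_at N q \<Longrightarrow> coord_vector N q c u c = u"
  by (simp add: coord_vector_def coord_change_self)

lemma coord_vector_tangent: "c \<in> charts_at N q \<Longrightarrow> coord_vector N q c u \<in> tangent_space N q"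
  unfolding tangent_space_def coord_vector_def by (auto intro: coord_change_compose)

lemma open_smooth_map_domain:
  fixes M :: "('q, 'b::euclidean_space) riemannian"
  assumes M: "charted M" and f: "smooth_map N M f" and c: "c \<in> atlas N" and d: "d \<in> atlas M"
  shows "open (snd c ` (fst c \<inter> f -` fst d))"
proof -
  have "continuous_map (top_of N) (top_of M) f" using f by (simp add: smooth_map_def)
  then have "openin (top_of N) {q \<in> topspace (top_of N). f q \<in> fst d}"
    using charted.openin_chart[OF M d] by (rule openin_continuous_map_preimage)
  then have "open (snd c ` (fst c \<inter> {q \<in> topspace (top_of N). f q \<in> fst d}))"
    by (rule open_chart_image[OF c])
  also have "fst c \<inter> {q \<in> topspace (top_of N). f q \<in> fst d} = fst c \<inter> f -` fst d"
    using chart_subset_topspace[OF c] by blast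
  finally show ?thesis .
qed

text \<open>\<open>differential\<close> is defined through \<open>chart_at N q\<close>. The same
  coordinate expression of \<open>f\<close> is differentiated once by changing the chart in the
  source and once by changing it in the target, and uniqueness equates the results.\<close>

lemma differential_coord_vector:
  fixes M :: "('q, 'b::euclidean_space) riemannian"
  assumes M: "charted M" and f: "smooth_map N M f"
    and c: "c \<in> charts_at N q" and d: "d \<in> charts_at M (f q)"
  shows "differential N M f q (coord_vector N q c u) =
    coord_vector M (f q) d (frechet_derivative (snd d \<circ> f \<circ> chart_inv c) (at (snd c q)) u)"
proof
  interpret M: charted M by fact
  note c' = charts_atD[OF c]
  have rep: "((snd e \<circ> f \<circ> chart_inv b) has_derivative frechet_derivative (snd e \<circ> f \<circ> chart_inv b) (at (snd b q)))
      (at (snd b q))" if "b \<in> charts_at N q" "e \<in> charts_at M (f q)" for b e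
  proof (rule smooth_on_has_derivative)
    show "smooth_on (snd b ` (fst b \<inter> f -` fst e)) (snd e \<circ> f \<circ> chart_inv b)"
      using f charts_atD[OF that(1)] M.charts_atD[OF that(2)] unfolding smooth_map_def by blast
    show "snd b q \<in> snd b ` (fst b \<inter> f -` fst e)"
      using charts_atD[OF that(1)] M.charts_atD[OF that(2)] by blast
  qed
  fix e
  show "differential N M f q (coord_vector N q c u) e =
    coord_vector M (f q) d (frechet_derivative (snd d \<circ> f \<circ> chart_inv c) (at (snd c q)) u) e"
  proof (cases "e \<in> charts_at M (f q)")
    case e: True
    note d' = M.charts_atD[OF d] and e' = M.charts_atD[OF e]
    let ?b = "chart_at N q"
    have b: "?b \<in> charts_at N q" using c by (rule chart_at_in')
    have 1: "((snd e \<circ> f \<circ> chart_inv c) has_derivative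
        (\<lambda>u. frechet_derivative (snd e \<circ> f \<circ> chart_inv ?b) (at (snd ?b q)) (coord_change c ?b q u))) (at (snd c q))"
      by (rule has_derivative_chart_change[OF c b rep[OF b e]])
    have "((snd e \<circ> chart_inv d) has_derivative coord_change d e (f q)) (at ((snd d \<circ> f \<circ> chart_inv c) (snd c q)))"
      using M.has_derivative_transition[OF d e] c' by simp
    from has_derivative_compose[OF rep[OF c d] this]
    have "((\<lambda>x. (snd e \<circ> chart_inv d) ((snd d \<circ> f \<circ> chart_inv c) x)) has_derivative
      (\<lambda>u. coord_change d e (f q) (frechet_derivative (snd d \<circ> f \<circ> chart_inv c) (at (snd c q)) u))) (at (snd c q))" .
    then have 2: "((snd e \<circ> f \<circ> chart_inv c) has_derivative
      (\<lambda>u. coord_change d e (f q) (frechet_derivative (snd d \<circ> f \<circ> chart_inv c) (at (snd c q)) u))) (at (snd c q))"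
      by (rule has_derivative_transform_within_open[OF _ open_smooth_map_domain[OF M f c'(1) d'(1)]])
        (use c' d' in auto)
    show ?thesis
      using fun_cong[OF has_derivative_unique[OF 1 2], of u] e b
      by (simp add: differential_def coord_vector_def Let_def)
  qed (simp add: differential_def coord_vector_def)
qed

lemma metric_in_chart:
  "c \<in> charts_at N q \<Longrightarrow>
    metric_in N c (snd c q) u v = metric N q (coord_vector N q c u) (coord_vector N q c v)"
  by (simp add: metric_in_def charts_at_def)

text \<open>The chart is the one that \<open>riemann_tensor\<close> selects, and there a coordinate
  vector evaluates to its own coordinates.\<close>

lemma sec_coord_vector:
  assumes q: "q \<in> topspace (top_of N)"
  defines "c \<equiv> chart_at N q"
  defines "g \<equiv> metric_in N c (snd c q)"
  shows "sec N q (coord_vector N q c u) (coord_vector N q c v) =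
    g (curvature_operator (metric_in N c) (\<lambda>_. u) (\<lambda>_. v) (\<lambda>_. v) (snd c q)) u /
    (g u u * g v v - (g u v)\<^sup>2)"
proof -
  have c: "c \<in> charts_at N q" unfolding c_def using q by (rule chart_at_in)
  show ?thesis
    unfolding sec_def riemann_tensor_def g_def metric_in_chart[OF c] Let_def c_def[symmetric]
    by (simp add: coord_vector_apply[OF c])
qed

end

lemma local_metric_metric_in:
  assumes N: "riemannian_manifold N" and c: "c \<in> atlas N" and U: "open U" "U \<subseteq> snd c ` fst c"
  shows "local_metric U (metric_in N c)"
proof
  show "smooth_on U (\<lambda>x. metric_in N c x u v)" for u v
    using N c U(2) smooth_on_subset unfolding riemannian_manifold_def by blast
qed (use assms in \<open>auto simp: riemannian_manifold_def\<close>)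

text \<open>The chart domain is cut down to the points that \<open>f\<close> sends into the domain
  of \<open>d\<close>. The isometry condition on tangent vectors becomes the one in coordinates
  through \<open>differential_coord_vector\<close>.\<close>

lemma local_immersion_charts:
  assumes N: "riemannian_manifold N" and M: "riemannian_manifold M" and f: "isometric_immersion N M f"
    and c: "c \<in> atlas N" and d: "d \<in> atlas M"
  shows "local_immersion (snd c ` (fst c \<inter> f -` fst d)) (metric_in N c) (snd d ` fst d) (metric_in M d)
    (snd d \<circ> f \<circ> chart_inv c)"
proof -
  interpret N: charted N using N by unfold_locales (simp add: riemannian_manifold_def)
  interpret M: charted M using M by unfold_locales (simp add: riemannian_manifold_def)
  have fs: "smooth_map N M f" using f by (simp add: isometric_immersion_def)
  have oU: "open (snd c ` (fst c \<inter> f -` fst d))"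
    by (rule N.open_smooth_map_domain[OF M.charted_axioms fs c d])
  have oV: "open (snd d ` fst d)"
    using M.open_chart_image[OF d M.openin_chart[OF d]] by simp
  interpret lN: local_metric "snd c ` (fst c \<inter> f -` fst d)" "metric_in N c"
    by (rule local_metric_metric_in[OF N c oU]) blast
  interpret lM: local_metric "snd d ` fst d" "metric_in M d"
    by (rule local_metric_metric_in[OF M d oV]) blast
  show ?thesis
  proof
    show "smooth_on (snd c ` (fst c \<inter> f -` fst d)) (snd d \<circ> f \<circ> chart_inv c)"
      using fs c d by (simp add: smooth_map_def)
    fix x assume "x \<in> snd c ` (fst c \<inter> f -` fst d)"
    then obtain q where q: "x = snd c q" "q \<in> fst c" "f q \<in> fst d" by blast
    show "(snd d \<circ> f \<circ> chart_inv c) x \<in> snd d ` fst d" using q c by simp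
    have cq: "c \<in> charts_at N q" and dq: "d \<in> charts_at M (f q)" using q c d by (simp_all add: charts_at_def)
    have qt: "q \<in> topspace (top_of N)" using q N.chart_subset_topspace[OF c] by blast
    show "metric_in N c x u v = metric_in M d ((snd d \<circ> f \<circ> chart_inv c) x)
       (frechet_derivative (snd d \<circ> f \<circ> chart_inv c) (at x) u)
       (frechet_derivative (snd d \<circ> f \<circ> chart_inv c) (at x) v)" for u v
    proof -
      have "metric_in N c x u v = metric N q (coord_vector N q c u) (coord_vector N q c v)"
        unfolding q(1) by (rule N.metric_in_chart[OF cq])
      also have "\<dots> = metric M (f q) (differential N M f q (coord_vector N q c u)) (differential N M f q (coord_vector N q c v))"
        using f qt N.coord_vector_tangent[OF cq] by (simp add: isometric_immersion_def)
      finally show ?thesis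
        using c q M.metric_in_chart[OF dq]
        by (simp add: N.differential_coord_vector[OF M.charted_axioms fs cq dq])
    qed
  qed
qed

section \<open>The dimension bound\<close>

theorem propositionC:
  fixes N :: "('p, 'n::euclidean_space) riemannian"
    and M :: "('q, 'm::euclidean_space) riemannian"
    and f :: "'p \<Rightarrow> 'q" and p :: 'p and k :: nat
  assumes "riemannian_manifold N" and "riemannian_manifold M"
    and "p \<in> topspace (top_of N)"
    and "k \<in> {1..DIM('n) - 1}"
    and "Ric_nonpos_at N k p"
    and "isometric_immersion N M f"
    and "\<And>u e. orthonormal_system N p k u e \<Longrightarrow>
      (\<Sum>i=1..k. sec M (f p) (differential N M f p u) (differential N M f p (e i))) > 0"
  shows "int DIM('n) \<le> \<lfloor>real (DIM('m) + k) / 2\<rfloor>"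
proof (rule ccontr)
  assume "\<not> int DIM('n) \<le> \<lfloor>real (DIM('m) + k) / 2\<rfloor>"
  then have dim: "DIM('m) + k < 2 * DIM('n)" by (simp add: le_floor_iff field_simps)
  interpret N: charted N using assms(1) by unfold_locales (simp add: riemannian_manifold_def)
  interpret M: charted M using assms(2) by unfold_locales (simp add: riemannian_manifold_def)
  have fs: "smooth_map N M f" using assms(6) by (simp add: isometric_immersion_def)
  have fp: "f p \<in> topspace (top_of M)"
    using fs assms(3) by (auto simp: smooth_map_def dest: continuous_map_image_subset_topspace)
  \<comment> \<open>These are the charts in which \<open>sec\<close> is evaluated on the two
    manifolds.\<close>
  define c where "c = chart_at N p"
  define d where "d = chart_at M (f p)"
  have c: "c \<in> charts_at N p" and d: "d \<in> charts_at M (f p)"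
    unfolding c_def d_def using N.chart_at_in[OF assms(3)] M.chart_at_in[OF fp] .
  note cd = N.charts_atD[OF c] M.charts_atD[OF d]
  define F where "F = snd d \<circ> f \<circ> chart_inv c"
  define x where "x = snd c p"
  define U where "U = snd c ` (fst c \<inter> f -` fst d)"
  interpret I: local_immersion U "metric_in N c" "snd d ` fst d" "metric_in M d" F
    unfolding U_def F_def by (rule local_immersion_charts[OF assms(1,2,6) cd(1,3)])
  have x: "x \<in> U" using cd by (auto simp: x_def U_def)
  have Fx: "F x = snd d (f p)" using cd by (simp add: F_def x_def)
  define g where "g = metric_in N c x"
  define h where "h = metric_in M d (F x)"
  define L where "L u = I.F1 u x" for u
  define \<beta> where "\<beta> = I.second_fundamental_form x"
  note V = I.F_into[OF x]
  have L: "linear L" unfolding L_def by (rule I.linear_F1[OF x])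
  have gL: "g u v = h (L u) (L v)" for u v
    unfolding g_def h_def L_def by (rule I.isometric_F1[OF x])
  have h: "bilinear h" unfolding h_def by (rule I.M.bil[OF V])
  have "inj L"
  proof (subst linear_injective_0[OF L], intro allI impI)
    fix u assume "L u = 0"
    then have "g u u = 0" by (simp add: gL bilinear_lzero[OF h])
    then show "u = 0" using I.N.pos[OF x, of u] by (force simp: g_def)
  qed
  obtain u e where u: "g u u = 1" and ue: "\<And>i. i \<in> {1..k} \<Longrightarrow> g u (e i) = 0"
    and ee: "\<And>i j. i \<in> {1..k} \<Longrightarrow> j \<in> {1..k} \<Longrightarrow> g (e i) (e j) = (if i = j then 1 else 0)"
    and \<beta>0: "\<And>i. i \<in> {1..k} \<Longrightarrow> \<beta> u (e i) = 0"
    and \<beta>nn: "\<And>i. i \<in> {1..k} \<Longrightarrow> h (\<beta> u u) (\<beta> (e i) (e i)) \<ge> 0"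
  proof (rule otsuki[of g h L \<beta> k])
    show "g u v = g v u" "h w z = h z w" for u v w z
      unfolding g_def h_def by (rule I.N.sym[OF x], rule I.M.sym[OF V])
    show "u \<noteq> 0 \<Longrightarrow> g u u > 0" "w \<noteq> 0 \<Longrightarrow> h w w > 0" for u w
      unfolding g_def h_def by (rule I.N.pos[OF x], assumption) (rule I.M.pos[OF V], assumption)
    show "bilinear g" unfolding g_def by (rule I.N.bil[OF x])
    show "bilinear \<beta>" "\<beta> u v = \<beta> v u" for u v
      unfolding \<beta>_def by (rule I.bilinear_second_fundamental_form[OF x], rule I.second_fundamental_form_sym[OF x])
    show "h (\<beta> u v) (L w) = 0" for u v w
      unfolding \<beta>_def h_def L_def by (rule I.second_fundamental_form_normal[OF x])
  qed (use h L \<open>inj L\<close> dim in auto)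
  define u' where "u' = coord_vector N p c u"
  define e' where "e' i = coord_vector N p c (e i)" for i
  have g': "metric N p (coord_vector N p c a) (coord_vector N p c b) = g a b" for a b
    unfolding g_def x_def by (rule N.metric_in_chart[OF c, symmetric])
  have orth: "orthonormal_system N p k u' e'"
    unfolding orthonormal_system_def u'_def e'_def g'
    using u ue ee N.coord_vector_tangent[OF c] by simp
  have diff: "differential N M f p (coord_vector N p c v) = coord_vector M (f p) d (L v)" for v
    using N.differential_coord_vector[OF M.charted_axioms fs c d, of v]
    unfolding F_def[symmetric] x_def[symmetric] by (simp add: L_def I.F1_def)
  have "sec M (f p) (differential N M f p u') (differential N M f p (e' i)) \<le> sec N p u' (e' i)"
    if i: "i \<in> {1..k}" for i
  proof -
    \<comment> \<open>Orthonormality makes the denominator in \<open>sec\<close> equal to 1, and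
      \<open>gL\<close> carries this over to the images in \<open>M\<close>.\<close>
    have 1: "sec N p u' (e' i) = g (curvature_operator (metric_in N c) (\<lambda>_. u) (\<lambda>_. e i) (\<lambda>_. e i) x) u"
      using N.sec_coord_vector[OF assms(3), of u "e i"] u ue[OF i] ee[OF i i]
      by (simp add: u'_def e'_def c_def[symmetric] x_def[symmetric] g_def[symmetric])
    have 2: "sec M (f p) (differential N M f p u') (differential N M f p (e' i)) =
        h (curvature_operator (metric_in M d) (\<lambda>_. L u) (\<lambda>_. L (e i)) (\<lambda>_. L (e i)) (F x)) (L u)"
      using M.sec_coord_vector[OF fp, of "L u" "L (e i)"] u ue[OF i] ee[OF i i]
      by (simp add: u'_def e'_def diff d_def[symmetric] Fx[symmetric] h_def[symmetric] gL)
    \<comment> \<open>With \<open>X = W = u\<close> and \<open>Y = Z = e i\<close>, the positive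
      correction in the Gauss equation vanishes and the subtracted one is nonnegative, so the
      curvature of \<open>M\<close> is at most that of \<open>N\<close>.\<close>
    have "h (\<beta> u (e i)) (\<beta> (e i) u) = 0" using \<beta>0[OF i] by (simp add: bilinear_lzero[OF h])
    moreover have "h (\<beta> (e i) (e i)) (\<beta> u u) \<ge> 0"
      using \<beta>nn[OF i] I.M.sym[OF V] by (simp add: h_def)
    ultimately show ?thesis
      unfolding 1 2 using I.gauss_equation[OF x, of u "e i" "e i" u]
      by (simp add: g_def h_def L_def \<beta>_def)
  qed
  then have "(\<Sum>i=1..k. sec M (f p) (differential N M f p u') (differential N M f p (e' i))) \<le>
      (\<Sum>i=1..k. sec N p u' (e' i))" by (intro sum_mono) 
  also have "\<dots> \<le> 0" using assms(5) orth by (simp add: Ric_nonpos_at_def)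
  finally show False using assms(7)[OF orth] by simp
qed

end
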